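(* Let $p\ge 2$, let $\mathcal M_1,\mathcal M_2\subset\mathcal E$ be $C^{p,1}$ embedded submanifolds, $\mathcal M=\mathcal M_1\cap\mathcal M_2$, fix $\bar x\in\mathcal M$, and let $\Omega_{\bar x}\subset\mathcal M$ and $K=\mathrm{cl}_{\mathcal M}\Omega_{\bar x}$ be the local sets described in the context. Suppose that, at every $x\in K$, $\mathcal M_1$ and $\mathcal M_2$ intersect cleanly, the alternating framework holds, and the decomposition property holds (all as defined in the context, with this $p\ge 2$). Then there exists $\rho_K>0$ such that for each $$(x,\eta)\in\mathcal D_K:=\{(x,\eta)\in \mathrm T\mathcal M:\ x\in\Omega_{\bar x},\ \|\eta\|<\rho_K\},$$ the iterates $x_0=x+\eta$, $x_{k+1}=\varphi(x_k)$ $(k\ge 0)$ are well-defined. Moreover, the limit $$\psi(x,\eta)=\lim_{k\to\infty}x_k$$ defines a $C^1$ mapping $\psi:\mathcal D_K\to\mathcal M$, and $\psi(x,0)=x$ and $\mathrm D_\eta\psi(x,0)=I$ for all $x\in K$. Hence $\psi$ is a (first-order) retraction on $\mathcal M$ over $\mathcal D_K$.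
   Context: Notation. $\mathcal E$ is a Euclidean space with norm $\|\cdot\|$; $\mathbb B(x,r)$ is the open ball. For a closed set $D$, $\mathcal P_D$ is the orthogonal projection onto $D$ (locally single-valued near a submanifold and treated as such) and $d_D(x)=\|x-\mathcal P_D(x)\|$. A map is $C^{p,1}$ if it is $p$ times continuously differentiable with locally Lipschitz $p$-th derivative; a $C^{p,1}$ embedded submanifold has $C^{p,1}$ local defining functions of full rank. $\mathrm T_x\mathcal M$ and $\mathrm N_x\mathcal M=(\mathrm T_x\mathcal M)^\perp$ are the tangent and normal spaces, and $\mathrm T\mathcal M=\{(x,\eta):x\in\mathcal M,\ \eta\in\mathrm T_x\mathcal M\}\subset\mathcal E\times\mathcal E$ is the tangent bundle. Clean intersection. $\mathcal M_1,\mathcal M_2$ intersect cleanly at $x\in\mathcal M$ if $\mathcal M$ is a $C^{p,1}$ embedded submanifold in a neighborhood of $x$ and $\mathrm T_y\mathcal M=\mathrm T_y\mathcal M_1\cap\mathrm T_y\mathcal M_2$ for all $y$ in a neighborhood of $x$ in $\mathcal M$. Alternating framework. There are an open neighborhood $\mathcal U_{\bar x}\subset\mathcal E$ of the base point and $C^{p-1}$ maps $\phi_1:\mathcal U_{\bar x}\to\mathcal M_1$, $\phi_2:\mathcal U_{\bar x}\to\mathcal E$, with $\varphi:=\phi_1\circ\phi_2$ (where defined), such that one of the following holds: (i) $\phi_1=\mathcal P_{\mathcal M_1}$ on $\mathcal U_{\bar x}$ and $\phi_2$ is first-order consistent with $\mathcal P_{\mathcal M_2}$; (ii) $\phi_2=\mathcal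 P_{\mathcal M_2}$ on $\mathcal U_{\bar x}$ and $\phi_1$ is first-order consistent with $\mathcal P_{\mathcal M_1}$; (iii) for each $i\in\{1,2\}$, $\phi_i$ is first-order consistent with $\mathcal P_{\mathcal M_i}$ and $\phi_i(\mathcal U_{\bar x})\subset\mathcal M_i$. Here $\phi_i$ is first-order consistent with $\mathcal P_{\mathcal M_i}$ if $\|\phi_i(y)-\mathcal P_{\mathcal M_i}(y)\|=o(d_{\mathcal M_i}(y))$ as $y\to x$, for $x\in\mathcal U_{\bar x}\cap\mathcal M_i$. When the framework is assumed at every $x\in K$, it is for the same maps $\phi_1,\phi_2$. Local sets. $\mathbf U_{\bar x}\subset\mathcal M$ and $\mathcal U_{\bar x}\subset\mathcal E$ are open neighborhoods of $\bar x$ such that: $\mathrm T_x\mathcal M=\mathrm T_x\mathcal M_1\cap\mathrm T_x\mathcal M_2$ for $x\in\mathbf U_{\bar x}$, and there is $c<1$ with $\|\mathcal P_{\mathrm T_x\mathcal M_1}\mathcal P_{\mathrm T_x\mathcal M_2}-\mathcal P_{\mathrm T_x\mathcal M}\|\le c$ for $x\in\mathbf U_{\bar x}$; the maps $\mathcal P_{\mathcal M_1},\mathcal P_{\mathcal M_2},\mathcal P_{\mathcal M},\phi_1,\phi_2$ are well-defined and $C^{p-1,1}$ on $\mathcal U_{\bar x}$; and there is $\kappa>0$ with $d_{\mathcal M}(x)\le\kappa\,d_{\mathcal M_2}(x)$ for $x\in\mathcal M_1\cap\mathcal U_{\bar x}$. $\Omega_{\bar x}\subset\mathbf U_{\bar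 x}\cap\mathcal U_{\bar x}$ is a neighborhood of $\bar x$ open in $\mathcal M$ whose closure $K=\mathrm{cl}_{\mathcal M}\Omega_{\bar x}$ in $\mathcal M$ is compact and contained in $\mathbf U_{\bar x}\cap\mathcal U_{\bar x}$. For $\delta>0$, $\mathcal N_\delta(K)=\{y\in\mathcal E:d_K(y)<\delta\}$. All statements are understood to hold after possibly shrinking $\Omega_{\bar x}$ and $\mathcal U_{\bar x}$ while keeping these inclusions. Radius $\delta_K$. $\delta_K>0$ is a radius with $\mathcal N_{\delta_K}(K)\subset\mathcal U_{\bar x}$ for which there are $\tau_K\in(0,1)$, $\rho_K\in(0,\delta_K]$ and $C_K>1$ such that: for $y\in\mathcal M_1\cap\mathcal N_{\delta_K}(K)$, $\varphi(y)$ is well-defined and $d_{\mathcal M_2}(\varphi(y))\le\tau_K d_{\mathcal M_2}(y)$; and for $x\in\Omega_{\bar x}$, $\eta\in\mathrm T_x\mathcal M$, $\|\eta\|\le\rho_K$, the iterates $x_0=x+\eta$, $x_{k+1}=\varphi(x_k)$ are well-defined, satisfy $x_0,\phi_2(x_0)\in\mathcal N_{\delta_K}(K)$, and for $k\ge1$ satisfy $x_k\in\mathcal M_1\cap\mathcal N_{\delta_K}(K)$, $\phi_2(x_k)\in\mathcal N_{\delta_K}(K)$, $\|x_k-x\|\le C_K\|\eta\|$. (Such constants exist under clean intersection and the alternating framework on $K$.) Decomposition property. For each $i\in\{1,2\}$ there are maps $R_{\mathrm N_i},R_{\mathrm T_i}$ on $K\times\mathbb B(0,\delta_K)$, of class $C^{p-1}$,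 with $R_{\mathrm N_i}(x,u)\in\mathrm N_x\mathcal M_i$, $R_{\mathrm T_i}(x,u)\in\mathrm T_x\mathcal M_i$ and $$\phi_i(x+u)=x+\mathcal P_{\mathrm T_x\mathcal M_i}(u)+R_{\mathrm N_i}(x,u)+R_{\mathrm T_i}(x,u),\qquad x\in K,\ u\in\mathbb B(0,\delta_K).$$ (i) If $p=2$: $R_{\mathrm N_i}(x,u)=o(\|u\|)$ and $R_{\mathrm T_i}(x,u)=o(\|u\|)$ as $u\to0$, uniformly in $x\in K$, and $\mathrm D\varphi$ is Lipschitz on $\mathcal N_{\delta_K}(K)$. (ii) If $p\ge3$: for $x\in K$ and $u$ with $x+u\in\mathcal N_{\delta_K}(K)$ and $\mathcal P_{\mathrm N_x\mathcal M_i}(u)=o(\|u\|)$, one has $R_{\mathrm N_i}(x,u)=O(\|u\|^2)$ and $R_{\mathrm T_i}(x,u)=o(\|u\|^2)$ as $u\to0$, uniformly in $x\in K$; and $\varphi\in C^{2,1}$ with $\mathrm D^2\varphi$ Lipschitz on $\mathcal N_{\delta_K}(K)$. First-order retraction over $\mathcal D_K$: a $C^1$ map $\psi:\mathcal D_K\to\mathcal M$ such that every curve $c(t)=\psi(x,t\eta)$ satisfies $c(0)=x$ and $c'(0)=\eta$ (equivalently $c(t)=x+t\eta+o(t)$). $\mathrm D_\eta\psi(x,0)$ is the derivative at $0$ of $\eta\mapsto\psi(x,\eta)$ on $\mathrm T_x\mathcal M$, and $I$ is the identity of $\mathrm T_x\mathcal M$; for $x\in K\setminus\Omega_{\bar x}$,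 $\psi(x,\cdot)$ is given by the same limit. *)

theory Defs
  imports "HOL-Analysis.Analysis" "HOL-Library.Landau_Symbols"
begin

section \<open>Maps of class \<open>C\<^sup>k\<close> and \<open>C\<^sup>k\<^sup>,\<^sup>1\<close>\<close>

text \<open>
  \<open>iter_deriv [v\<^sub>1, \<dots>, v\<^sub>k] f x\<close> is the \<open>k\<close>-th Frechet derivative of \<open>f\<close> at \<open>x\<close> applied to
  \<open>v\<^sub>1, \<dots>, v\<^sub>k\<close>. On finite-dimensional spaces, differentiability and continuity of a derivative
  are equivalent to those of all its evaluations at fixed directions.
\<close>

primrec iter_deriv ::
    "'a::real_normed_vector list \<Rightarrow> ('a \<Rightarrow> 'b::real_normed_vector) \<Rightarrow> 'a \<Rightarrow> 'b" where
  "iter_deriv [] f = f"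
| "iter_deriv (v # vs) f = (\<lambda>x. frechet_derivative (iter_deriv vs f) (at x) v)"

text \<open>The next three notions are meant for open sets \<open>U\<close>.\<close>

definition Ck_on ::
    "nat \<Rightarrow> 'a::euclidean_space set \<Rightarrow> ('a \<Rightarrow> 'b::euclidean_space) \<Rightarrow> bool" where
  "Ck_on k U f \<longleftrightarrow>
     (\<forall>vs. length vs < k \<longrightarrow> (\<forall>x\<in>U. iter_deriv vs f differentiable (at x))) \<and>
     (\<forall>vs. length vs = k \<longrightarrow> continuous_on U (iter_deriv vs f))"

definition Ck1_on ::
    "nat \<Rightarrow> 'a::euclidean_space set \<Rightarrow> ('a \<Rightarrow> 'b::euclidean_space) \<Rightarrow> bool" where
  "Ck1_on k U f \<longleftrightarrow>
     Ck_on k U f \<and>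
     (\<forall>vs. length vs = k \<longrightarrow>
        (\<forall>x\<in>U. \<exists>e>0. \<exists>L. L-lipschitz_on (ball x e \<inter> U) (iter_deriv vs f)))"

text \<open>
  The supremum over unit directions is the operator norm of a multilinear map, so \<open>L\<close> is a
  (global) Lipschitz constant of \<open>D\<^sup>k f\<close> on \<open>U\<close>.
\<close>

definition lipschitz_deriv_on ::
    "nat \<Rightarrow> 'a::euclidean_space set \<Rightarrow> ('a \<Rightarrow> 'b::euclidean_space) \<Rightarrow> bool" where
  "lipschitz_deriv_on k U f \<longleftrightarrow>
     (\<exists>L. \<forall>vs. length vs = k \<and> (\<forall>v\<in>set vs. norm v \<le> 1) \<longrightarrow> L-lipschitz_on U (iter_deriv vs f))"

text \<open>
  On a set that need not be open (such as a subset of a submanifold), a map is \<open>C\<^sup>k\<close> if near every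
  point of the set it is the restriction of a \<open>C\<^sup>k\<close> map on an open set of the ambient space.
\<close>

definition Ck_on_subset ::
    "nat \<Rightarrow> 'a::euclidean_space set \<Rightarrow> ('a \<Rightarrow> 'b::euclidean_space) \<Rightarrow> bool" where
  "Ck_on_subset k S f \<longleftrightarrow>
     (\<forall>s\<in>S. \<exists>W g. open W \<and> s \<in> W \<and> Ck_on k W g \<and> (\<forall>y\<in>S \<inter> W. g y = f y))"


section \<open>Projections and distances\<close>

text \<open>
  The projection onto \<open>D\<close> is \<^const>\<open>closest_point\<close>, single-valued at \<open>y\<close> under the following condition.
\<close>

definition proj_well_defined :: "'a::euclidean_space set \<Rightarrow> 'a \<Rightarrow> bool" where
  "proj_well_defined D y \<longleftrightarrow> (\<exists>!z. z \<in> D \<and> (\<forall>w\<in>D. dist y z \<le> dist y w))"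

text \<open>
  The distance to \<open>D\<close> is \<^const>\<open>infdist\<close>, which is the distance to the projection whenever the
  latter exists.
\<close>

lemma infdist_eq_norm_closest_point:
  fixes D :: "'a::euclidean_space set"
  assumes "\<exists>z\<in>D. \<forall>w\<in>D. dist y z \<le> dist y w"
  shows "infdist y D = norm (y - closest_point D y)"
proof -
  let ?z = "closest_point D y"
  have z: "?z \<in> D \<and> (\<forall>w\<in>D. dist y ?z \<le> dist y w)"
    unfolding closest_point_def by (rule someI_ex) (use assms in blast)
  then have "infdist y D \<le> dist y ?z"
    by (simp add: infdist_le)
  moreover have "dist y ?z \<le> infdist y D"
    using z by (auto simp: infdist_def intro!: cINF_greatest)
  ultimately show ?thesis
    by (simp add: dist_norm)
qed

definition tube :: "real \<Rightarrow> 'a::euclidean_space set \<Rightarrow> 'a set" where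
  "tube \<delta> K = {y. infdist y K < \<delta>}"


section \<open>Embedded submanifolds\<close>

text \<open>
  A local defining function takes its values in a linear subspace \<open>F\<close> of the ambient space (in place
  of a coordinate space of dimension the codimension), onto which its derivatives are surjective.
\<close>

definition embedded_submanifold :: "nat \<Rightarrow> 'a::euclidean_space set \<Rightarrow> bool" where
  "embedded_submanifold p M \<longleftrightarrow>
     (\<forall>x\<in>M. \<exists>U F. \<exists>h :: 'a \<Rightarrow> 'a. open U \<and> x \<in> U \<and> subspace F \<and> h ` U \<subseteq> F \<and> Ck1_on p U h \<and>
        (\<forall>y\<in>U. range (frechet_derivative h (at y)) = F) \<and>
        M \<inter> U = {y \<in> U. h y = 0})"

definition tangent_space :: "'a::euclidean_space set \<Rightarrow> 'a \<Rightarrow> 'a set" where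
  "tangent_space M x =
     {v. \<exists>e c. e > 0 \<and> Ck_on 1 {-e<..<e::real} c \<and> c ` {-e<..<e} \<subseteq> M \<and>
           c 0 = x \<and> (c has_vector_derivative v) (at 0)}"

definition normal_space :: "'a::euclidean_space set \<Rightarrow> 'a \<Rightarrow> 'a set" where
  "normal_space M x = orthogonal_comp (tangent_space M x)"

definition tangent_bundle :: "'a::euclidean_space set \<Rightarrow> ('a \<times> 'a) set" where
  "tangent_bundle M = {(x, \<eta>). x \<in> M \<and> \<eta> \<in> tangent_space M x}"

definition intersect_cleanly_at ::
    "nat \<Rightarrow> 'a::euclidean_space set \<Rightarrow> 'a set \<Rightarrow> 'a \<Rightarrow> bool" where
  "intersect_cleanly_at p M1 M2 x \<longleftrightarrow>
     (\<exists>V. open V \<and> x \<in> V \<and> embedded_submanifold p (M1 \<inter> M2 \<inter> V)) \<and>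
     (\<exists>V. open V \<and> x \<in> V \<and>
        (\<forall>y \<in> M1 \<inter> M2 \<inter> V. tangent_space (M1 \<inter> M2) y = tangent_space M1 y \<inter> tangent_space M2 y))"


section \<open>The alternating framework\<close>

definition first_order_consistent ::
    "'a::euclidean_space set \<Rightarrow> ('a \<Rightarrow> 'a) \<Rightarrow> 'a set \<Rightarrow> bool" where
  "first_order_consistent D \<phi> V \<longleftrightarrow>
     (\<forall>x \<in> V \<inter> D. (\<lambda>y. norm (\<phi> y - closest_point D y)) \<in> o[at x](\<lambda>y. infdist y D))"

text \<open>
  Throughout, \<open>U\<close> is the common domain of \<open>\<phi>1\<close> and \<open>\<phi>2\<close>; the neighborhood \<open>V\<close> of the
  base point \<open>x\<close> may depend on \<open>x\<close>, whereas the maps do not.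
\<close>

definition alternating_framework_at ::
    "nat \<Rightarrow> 'a::euclidean_space set \<Rightarrow> 'a set \<Rightarrow> ('a \<Rightarrow> 'a) \<Rightarrow> ('a \<Rightarrow> 'a) \<Rightarrow> 'a set \<Rightarrow> 'a \<Rightarrow> bool" where
  "alternating_framework_at p M1 M2 \<phi>1 \<phi>2 U x \<longleftrightarrow>
     (\<exists>V. open V \<and> x \<in> V \<and> V \<subseteq> U \<and>
        Ck_on (p - 1) V \<phi>1 \<and> Ck_on (p - 1) V \<phi>2 \<and> \<phi>1 ` V \<subseteq> M1 \<and>
        ((\<forall>y\<in>V. \<phi>1 y = closest_point M1 y) \<and> first_order_consistent M2 \<phi>2 V \<or>
         (\<forall>y\<in>V. \<phi>2 y = closest_point M2 y) \<and> first_order_consistent M1 \<phi>1 V \<or>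
         first_order_consistent M1 \<phi>1 V \<and> \<phi>1 ` V \<subseteq> M1 \<and>
         first_order_consistent M2 \<phi>2 V \<and> \<phi>2 ` V \<subseteq> M2))"

text \<open>\<open>\<phi>1 \<circ> \<phi>2\<close> is defined at \<open>y\<close> iff \<open>y\<close> and \<open>\<phi>2 y\<close> lie in the common domain \<open>U\<close>.\<close>

definition alt_defined :: "('a \<Rightarrow> 'a) \<Rightarrow> 'a set \<Rightarrow> 'a \<Rightarrow> bool" where
  "alt_defined \<phi>2 U y \<longleftrightarrow> y \<in> U \<and> \<phi>2 y \<in> U"

definition alt_iterate :: "('a \<Rightarrow> 'a) \<Rightarrow> ('a \<Rightarrow> 'a) \<Rightarrow> 'a \<Rightarrow> nat \<Rightarrow> 'a" where
  "alt_iterate \<phi>1 \<phi>2 y k = ((\<phi>1 \<circ> \<phi>2) ^^ k) y"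

definition iterates_well_defined :: "('a \<Rightarrow> 'a) \<Rightarrow> ('a \<Rightarrow> 'a) \<Rightarrow> 'a set \<Rightarrow> 'a \<Rightarrow> bool" where
  "iterates_well_defined \<phi>1 \<phi>2 U y \<longleftrightarrow> (\<forall>k. alt_defined \<phi>2 U (alt_iterate \<phi>1 \<phi>2 y k))"

definition alt_limit ::
    "('a \<Rightarrow> 'a) \<Rightarrow> ('a \<Rightarrow> 'a) \<Rightarrow> 'a \<times> 'a \<Rightarrow> 'a::euclidean_space" where
  "alt_limit \<phi>1 \<phi>2 = (\<lambda>(x, \<eta>). lim (alt_iterate \<phi>1 \<phi>2 (x + \<eta>)))"


section \<open>Local sets, radius and decomposition\<close>

definition local_sets ::
    "nat \<Rightarrow> 'a::euclidean_space set \<Rightarrow> 'a set \<Rightarrow> ('a \<Rightarrow> 'a) \<Rightarrow> ('a \<Rightarrow> 'a) \<Rightarrow>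
     'a \<Rightarrow> 'a set \<Rightarrow> 'a set \<Rightarrow> 'a set \<Rightarrow> 'a set \<Rightarrow> bool" where
  "local_sets p M1 M2 \<phi>1 \<phi>2 xbar U\<^sub>M U \<Omega> K \<longleftrightarrow>
     (let M = M1 \<inter> M2 in
        openin (top_of_set M) U\<^sub>M \<and> xbar \<in> U\<^sub>M \<and> open U \<and> xbar \<in> U \<and>
        (\<forall>x\<in>U\<^sub>M. tangent_space M x = tangent_space M1 x \<inter> tangent_space M2 x) \<and>
        (\<exists>c<1. \<forall>x\<in>U\<^sub>M.
           onorm (\<lambda>u. closest_point (tangent_space M1 x) (closest_point (tangent_space M2 x) u)
                     - closest_point (tangent_space M x) u) \<le> c) \<and>
        (\<forall>D\<in>{M1, M2, M}. (\<forall>y\<in>U. proj_well_defined D y) \<and> Ck1_on (p - 1) U (closest_point D)) \<and>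
        Ck1_on (p - 1) U \<phi>1 \<and> Ck1_on (p - 1) U \<phi>2 \<and>
        (\<exists>\<kappa>>0. \<forall>x \<in> M1 \<inter> U. infdist x M \<le> \<kappa> * infdist x M2) \<and>
        openin (top_of_set M) \<Omega> \<and> xbar \<in> \<Omega> \<and> \<Omega> \<subseteq> U\<^sub>M \<inter> U \<and>
        K = top_of_set M closure_of \<Omega> \<and> compact K \<and> K \<subseteq> U\<^sub>M \<inter> U)"

definition admissible_radius ::
    "'a::euclidean_space set \<Rightarrow> 'a set \<Rightarrow> ('a \<Rightarrow> 'a) \<Rightarrow> ('a \<Rightarrow> 'a) \<Rightarrow>
     'a set \<Rightarrow> 'a set \<Rightarrow> 'a set \<Rightarrow> real \<Rightarrow> bool" where
  "admissible_radius M1 M2 \<phi>1 \<phi>2 U \<Omega> K \<delta> \<longleftrightarrow>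
     \<delta> > 0 \<and> tube \<delta> K \<subseteq> U \<and>
     (\<exists>\<tau> \<rho> C. 0 < \<tau> \<and> \<tau> < 1 \<and> 0 < \<rho> \<and> \<rho> \<le> \<delta> \<and> C > 1 \<and>
        (\<forall>y \<in> M1 \<inter> tube \<delta> K.
           alt_defined \<phi>2 U y \<and> infdist ((\<phi>1 \<circ> \<phi>2) y) M2 \<le> \<tau> * infdist y M2) \<and>
        (\<forall>x\<in>\<Omega>. \<forall>\<eta> \<in> tangent_space (M1 \<inter> M2) x. norm \<eta> \<le> \<rho> \<longrightarrow>
           (let X = alt_iterate \<phi>1 \<phi>2 (x + \<eta>) in
              iterates_well_defined \<phi>1 \<phi>2 U (x + \<eta>) \<and>
              X 0 \<in> tube \<delta> K \<and> \<phi>2 (X 0) \<in> tube \<delta> K \<and>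
              (\<forall>k\<ge>1. X k \<in> M1 \<inter> tube \<delta> K \<and> \<phi>2 (X k) \<in> tube \<delta> K \<and>
                      norm (X k - x) \<le> C * norm \<eta>))))"

text \<open>
  The uniform little-o for \<open>p = 2\<close> is expressed by the filter \<open>principal K \<times>\<^sub>F at 0\<close>. For \<open>p \<ge> 3\<close>
  the condition that the normal part of \<open>u\<close> is \<open>o(norm u)\<close> restricts a family of vectors tending to
  zero; letting the base points vary along the sequence in \<open>K\<close> makes the conclusion uniform in \<open>x\<close>.
\<close>

definition map_decomposition ::
    "nat \<Rightarrow> 'a::euclidean_space set \<Rightarrow> ('a \<Rightarrow> 'a) \<Rightarrow> 'a set \<Rightarrow> real \<Rightarrow> bool" where
  "map_decomposition p D \<phi> K \<delta> \<longleftrightarrow>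
     (\<exists>RN RT :: 'a \<times> 'a \<Rightarrow> 'a.
        Ck_on_subset (p - 1) (K \<times> ball 0 \<delta>) RN \<and> Ck_on_subset (p - 1) (K \<times> ball 0 \<delta>) RT \<and>
        (\<forall>x\<in>K. \<forall>u \<in> ball 0 \<delta>.
           RN (x, u) \<in> normal_space D x \<and> RT (x, u) \<in> tangent_space D x \<and>
           \<phi> (x + u) = x + closest_point (tangent_space D x) u + RN (x, u) + RT (x, u)) \<and>
        (p = 2 \<longrightarrow>
           (\<lambda>(x, u). norm (RN (x, u))) \<in> o[principal K \<times>\<^sub>F at 0](\<lambda>(x, u). norm u) \<and>
           (\<lambda>(x, u). norm (RT (x, u))) \<in> o[principal K \<times>\<^sub>F at 0](\<lambda>(x, u). norm u)) \<and>
        (p \<ge> 3 \<longrightarrow>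
           (\<forall>x u :: nat \<Rightarrow> 'a.
              (\<forall>n. x n \<in> K \<and> u n \<in> ball 0 \<delta> \<and> x n + u n \<in> tube \<delta> K) \<and> u \<longlonglongrightarrow> 0 \<and>
              (\<lambda>n. norm (closest_point (normal_space D (x n)) (u n))) \<in> o(\<lambda>n. norm (u n)) \<longrightarrow>
              (\<lambda>n. norm (RN (x n, u n))) \<in> O(\<lambda>n. norm (u n) ^ 2) \<and>
              (\<lambda>n. norm (RT (x n, u n))) \<in> o(\<lambda>n. norm (u n) ^ 2))))"

definition decomposition_property ::
    "nat \<Rightarrow> 'a::euclidean_space set \<Rightarrow> 'a set \<Rightarrow> ('a \<Rightarrow> 'a) \<Rightarrow> ('a \<Rightarrow> 'a) \<Rightarrow>
     'a set \<Rightarrow> 'a set \<Rightarrow> real \<Rightarrow> bool" where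
  "decomposition_property p M1 M2 \<phi>1 \<phi>2 U K \<delta> \<longleftrightarrow>
     map_decomposition p M1 \<phi>1 K \<delta> \<and> map_decomposition p M2 \<phi>2 K \<delta> \<and>
     (\<forall>y \<in> tube \<delta> K. alt_defined \<phi>2 U y) \<and>
     (p = 2 \<longrightarrow> Ck_on 1 (tube \<delta> K) (\<phi>1 \<circ> \<phi>2) \<and> lipschitz_deriv_on 1 (tube \<delta> K) (\<phi>1 \<circ> \<phi>2)) \<and>
     (p \<ge> 3 \<longrightarrow> Ck1_on 2 (tube \<delta> K) (\<phi>1 \<circ> \<phi>2) \<and> lipschitz_deriv_on 2 (tube \<delta> K) (\<phi>1 \<circ> \<phi>2))"


section \<open>First-order retractions\<close>

definition first_order_retraction ::
    "'a::euclidean_space set \<Rightarrow> ('a \<times> 'a) set \<Rightarrow> ('a \<times> 'a \<Rightarrow> 'a) \<Rightarrow> bool" where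
  "first_order_retraction M D \<psi> \<longleftrightarrow>
     Ck_on_subset 1 D \<psi> \<and> \<psi> ` D \<subseteq> M \<and>
     (\<forall>(x, \<eta>) \<in> D. \<psi> (x, 0) = x \<and> ((\<lambda>t. \<psi> (x, t *\<^sub>R \<eta>)) has_vector_derivative \<eta>) (at 0))"

end

theory Submission
  imports Defs
begin

text \<open>
  The limit depends on \<open>(x, \<eta>)\<close> only through \<open>x + \<eta>\<close>: with \<open>\<phi> = \<phi>1 \<circ> \<phi>2\<close> and
  \<open>\<Psi> y = lim \<phi>\<^sup>k y\<close> one has \<open>\<psi> (x, \<eta>) = \<Psi> (x + \<eta>)\<close>. The proof shows that \<open>\<Psi>\<close> is defined and
  \<open>C\<^sup>1\<close> on an open neighbourhood of \<open>K\<close> in the whole space, with values in \<open>M = M1 \<inter> M2\<close>, and that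
  its derivative at a point of \<open>M\<close> fixes the tangent vectors of \<open>M\<close>. The uniform radius comes from a Lebesgue number of a cover of the compact \<open>K\<close>.

  Locally, the argument has three ingredients.

  First, the derivative of \<open>\<phi>\<close> on \<open>M\<close>. A \<open>C\<^sup>1\<close> metric projection has, at a point \<open>x\<close> of its
  set, the orthogonal projection onto the tangent space as derivative
  (\<open>has_derivative_closest_point\<close>), and a first-order consistent map has the same derivative
  (\<open>first_order_consistent_has_derivative\<close>). So \<open>D\<phi>(z) = P1 P2\<close> for \<open>z \<in> M\<close>, where \<open>P1\<close>, \<open>P2\<close>
  project onto the tangent spaces of \<open>M1\<close>, \<open>M2\<close>. By clean intersection \<open>P1 P2\<close> is the identity on
  the tangent space of \<open>M\<close>, and by the angle bound it contracts the orthogonal complement.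

  Second, the orbits. Points of \<open>M\<close> are fixed by \<open>\<phi>\<close>, so a step from \<open>y \<in> M1\<close> has length at most a
  multiple of the distance of \<open>y\<close> to \<open>M\<close>, hence of its distance to \<open>M2\<close>, which decreases
  geometrically. Orbits that start near a point of \<open>M\<close> therefore stay near it and converge at a
  uniform geometric rate (\<open>contracting_orbits_stay\<close>).

  Third, the derivatives \<open>D(\<phi>\<^sup>k)(y)\<close>. They are products of the operators \<open>D\<phi>(\<phi>\<^sup>j y)\<close>, which
  converge geometrically to \<open>D\<phi>(\<Psi> y)\<close> because \<open>D\<phi>\<close> is locally Lipschitz. Splitting such a product
  into its component in the tangent space of \<open>M\<close> at the limit and the rest shows that the products
  converge at a uniform geometric rate too (\<open>operator_products_geometric\<close>). Uniform convergence of the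
  derivatives gives \<open>\<Psi> \<in> C\<^sup>1\<close>, and at a point of \<open>M\<close> the limit is the orthogonal projection onto the
  tangent space (\<open>iteration_limit_C1\<close>).
\<close>

section \<open>Maps of class \<open>C\<^sup>1\<close> and \<open>C\<^sup>1\<^sup>,\<^sup>1\<close>\<close>

lemma Ck_on_1_iff:
  "Ck_on 1 U f \<longleftrightarrow> (\<forall>x\<in>U. f differentiable (at x)) \<and>
     (\<forall>v. continuous_on U (\<lambda>x. frechet_derivative f (at x) v))"
  unfolding Ck_on_def by (auto simp: length_Suc_conv)

lemma Ck_on_imp_Ck_on_1:
  assumes "Ck_on k U f" "k \<ge> 1"
  shows "Ck_on 1 U f"
proof (cases "k = 1")
  case False
  with assms have k: "k > 1" by simp
  have "continuous_on U (iter_deriv vs f)" if "length vs = 1" for vs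
    using assms(1) k that unfolding Ck_on_def
    by (intro continuous_at_imp_continuous_on ballI differentiable_imp_continuous_within) auto
  moreover have "f differentiable (at x)" if "x \<in> U" for x
    using assms(1) k that unfolding Ck_on_def by (metis iter_deriv.simps(1) list.size(3) not_less_zero linorder_neqE_nat)
  ultimately show ?thesis
    unfolding Ck_on_def by auto
qed (use assms in simp)

lemma Ck_on_1I:
  assumes "\<And>x. x \<in> U \<Longrightarrow> (f has_derivative f' x) (at x)"
    and "\<And>v. continuous_on U (\<lambda>x. f' x v)"
  shows "Ck_on 1 U f"
proof -
  have "frechet_derivative f (at x) = f' x" if "x \<in> U" for x
    using assms(1)[OF that] frechet_derivative_at by metis
  then show ?thesis
    unfolding Ck_on_1_iff using assms
    by (auto simp: differentiable_def cong: continuous_on_cong)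
qed

lemma has_derivative_frechet_derivative:
  assumes "Ck_on 1 U f" "x \<in> U"
  shows "(f has_derivative frechet_derivative f (at x)) (at x)"
  using assms unfolding Ck_on_1_iff frechet_derivative_works by blast

text \<open>
  The operator norm of a linear map is at most the sum of the norms of its values on the standard
  basis, so Lipschitz directional derivatives along the basis make the derivative itself Lipschitz.
\<close>

lemma locally_lipschitz_derivative:
  fixes f :: "'a::euclidean_space \<Rightarrow> 'b::euclidean_space"
  assumes f: "Ck_on 1 S f" and S: "ball x r \<subseteq> S"
    and lip: "\<And>b. b \<in> Basis \<Longrightarrow> \<exists>L. L-lipschitz_on (ball x r) (iter_deriv [b] f)"
  shows "\<exists>L. \<exists>f' :: 'a \<Rightarrow> 'a \<Rightarrow>\<^sub>L 'b.
    (\<forall>y\<in>ball x r. (f has_derivative blinfun_apply (f' y)) (at y)) \<and> L-lipschitz_on (ball x r) f'"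
proof -
  define f' where "f' y = Blinfun (frechet_derivative f (at y))" for y
  have der: "(f has_derivative frechet_derivative f (at y)) (at y)" if "y \<in> ball x r" for y
    using has_derivative_frechet_derivative[OF f] S that by blast
  then have f'_eq: "blinfun_apply (f' y) = frechet_derivative f (at y)" if "y \<in> ball x r" for y
    using has_derivative_bounded_linear[OF der[OF that]] by (simp add: f'_def bounded_linear_Blinfun_apply)
  obtain L where L: "\<And>b. b \<in> Basis \<Longrightarrow> (L b)-lipschitz_on (ball x r) (iter_deriv [b] f)"
    using lip by metis
  have "(\<Sum>b\<in>Basis. L b)-lipschitz_on (ball x r) f'"
  proof (rule lipschitz_onI)
    fix y z assume yz: "y \<in> ball x r" "z \<in> ball x r"
    have "dist (f' y) (f' z) \<le> (\<Sum>b\<in>Basis. norm ((f' y - f' z) b))"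
      unfolding dist_norm by (rule norm_blinfun_euclidean_le)
    also have "\<dots> \<le> (\<Sum>b\<in>Basis. L b * dist y z)"
    proof (rule sum_mono)
      fix b :: 'a assume "b \<in> Basis"
      from lipschitz_onD[OF L[OF this] yz]
      show "norm ((f' y - f' z) b) \<le> L b * dist y z"
        by (simp add: blinfun.diff_left f'_eq[OF yz(1)] f'_eq[OF yz(2)] dist_norm)
    qed
    finally show "dist (f' y) (f' z) \<le> (\<Sum>b\<in>Basis. L b) * dist y z"
      by (simp add: sum_distrib_right)
  qed (auto intro!: sum_nonneg lipschitz_on_nonneg[OF L])
  with der f'_eq show ?thesis by (intro exI[of _ "\<Sum>b\<in>Basis. L b"] exI[of _ f']) auto
qed

text \<open>
  The second derivatives are bounded on the compact ball, and the mean value inequality applies on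
  the convex open ball.
\<close>

lemma Ck_on_2_locally_lipschitz_directional:
  fixes f :: "'a::euclidean_space \<Rightarrow> 'b::euclidean_space"
  assumes f: "Ck_on 2 S f" and S: "cball x r \<subseteq> S"
  shows "\<exists>L. L-lipschitz_on (ball x r) (iter_deriv [b] f)"
proof -
  let ?h = "iter_deriv [b] f"
  let ?h' = "\<lambda>y. frechet_derivative ?h (at y)"
  have der: "(?h has_derivative ?h' y) (at y)" if "y \<in> S" for y
  proof -
    have "length [b] < 2" by simp
    with f that have "?h differentiable (at y)" unfolding Ck_on_def by blast
    then show ?thesis by (simp add: frechet_derivative_works)
  qed
  have "\<exists>B. \<forall>y\<in>cball x r. norm (?h' y w) \<le> B" for w
  proof -
    have "length [w, b] = 2" by simp
    with f have "continuous_on S (iter_deriv [w, b] f)" unfolding Ck_on_def by blast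
    then have "continuous_on (cball x r) (\<lambda>y. ?h' y w)"
      using S continuous_on_subset by auto
    then have "bounded ((\<lambda>y. ?h' y w) ` cball x r)"
      by (intro compact_imp_bounded compact_continuous_image compact_cball)
    then show ?thesis unfolding bounded_iff by blast
  qed
  then obtain B where B: "\<And>w y. y \<in> cball x r \<Longrightarrow> norm (?h' y w) \<le> B w" by metis
  let ?C = "max 0 (\<Sum>w\<in>Basis. B w)"
  have "?C-lipschitz_on (ball x r) ?h"
  proof (rule bounded_derivative_imp_lipschitz[where f' = ?h'])
    fix y assume y: "y \<in> ball x r"
    then have yS: "y \<in> S" using S by auto
    show "(?h has_derivative ?h' y) (at y within ball x r)"
      using der[OF yS] by (rule has_derivative_at_withinI)
    have bl: "bounded_linear (?h' y)" using der[OF yS] by (rule has_derivative_bounded_linear)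
    have "onorm (?h' y) = norm (Blinfun (?h' y))"
      by (simp only: norm_blinfun.rep_eq bounded_linear_Blinfun_apply[OF bl])
    also have "\<dots> \<le> (\<Sum>w\<in>Basis. norm (?h' y w))"
      using norm_blinfun_euclidean_le[of "Blinfun (?h' y)"] by (simp only: bounded_linear_Blinfun_apply[OF bl])
    also have "\<dots> \<le> (\<Sum>w\<in>Basis. B w)"
      using y by (intro sum_mono B) auto
    finally show "onorm (?h' y) \<le> ?C" by simp
  qed auto
  then show ?thesis by blast
qed

section \<open>Orthogonal projections\<close>

text \<open>
  Working with the linear map instead of \<^const>\<open>closest_point\<close> records that \<open>T\<close> is a subspace, which
  is not evident for a tangent space defined by curves.
\<close>

definition orth_projection :: "('a::euclidean_space \<Rightarrow> 'a) \<Rightarrow> 'a set \<Rightarrow> bool" where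
  "orth_projection Q T \<longleftrightarrow> bounded_linear Q \<and> range Q = T \<and> (\<forall>v\<in>T. Q v = v) \<and>
     (\<forall>w. \<forall>v\<in>T. (w - Q w) \<bullet> v = 0)"

lemma orth_projectionD:
  assumes "orth_projection Q T"
  shows "bounded_linear Q" "linear Q" "Q w \<in> T" "v \<in> T \<Longrightarrow> Q v = v" "v \<in> T \<Longrightarrow> (w - Q w) \<bullet> v = 0"
  using assms unfolding orth_projection_def by (blast intro: bounded_linear.linear)+

lemma orth_projection_orthogonal:
  assumes Q: "orth_projection Q T" and w: "\<And>v. v \<in> T \<Longrightarrow> w \<bullet> v = 0"
  shows "Q w = 0"
proof -
  have "(w - Q w) \<bullet> Q w = 0" "w \<bullet> Q w = 0"
    using w orth_projectionD[OF Q] by auto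
  then show ?thesis by (simp add: inner_diff_left)
qed

lemma norm_orth_projection_le:
  assumes "orth_projection Q T"
  shows "norm (Q w) \<le> norm w"
proof -
  have "Q w \<bullet> Q w = w \<bullet> Q w"
    using orth_projectionD(5)[OF assms orth_projectionD(3)[OF assms]] by (simp add: inner_diff_left)
  also have "\<dots> \<le> norm w * norm (Q w)" by (rule norm_cauchy_schwarz)
  finally have "norm (Q w) * norm (Q w) \<le> norm w * norm (Q w)"
    by (simp add: dot_square_norm power2_eq_square)
  then show ?thesis
    by (metis mult_right_le_imp_le norm_ge_zero order_le_less)
qed

lemma closest_point_orth_projection:
  assumes Q: "orth_projection Q T"
  shows "closest_point T w = Q w"
proof -
  have T: "subspace T"
    using Q linear_subspace_image[OF orth_projectionD(2)[OF Q] subspace_UNIV]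
    by (simp add: orth_projection_def)
  have "dist w (Q w) \<le> dist w z" if "z \<in> T" for z
  proof -
    have "Q w - z \<in> T" using T that orth_projectionD(3)[OF Q] by (simp add: subspace_diff)
    then have "orthogonal (w - Q w) (Q w - z)"
      using orth_projectionD(5)[OF Q] by (simp add: orthogonal_def)
    then have "(norm (w - z))\<^sup>2 = (norm (w - Q w))\<^sup>2 + (norm (Q w - z))\<^sup>2"
      using norm_add_Pythagorean by fastforce
    then have "(norm (w - Q w))\<^sup>2 \<le> (norm (w - z))\<^sup>2" by simp
    then show ?thesis by (simp add: dist_norm power2_le_iff_abs_le)
  qed
  then show ?thesis
    using closest_point_unique[of T "Q w" w] T orth_projectionD(3)[OF Q]
    by (simp add: subspace_imp_convex closed_subspace)
qed

text \<open>
  These two identities for nested subspaces say that the projection onto the tangent space of the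
  intersection is absorbed by each of the two larger projections. They make it both a left and a right
  neutral part of the product of the two.
\<close>

lemma orth_projection_absorb:
  assumes P: "orth_projection P S" and Q: "orth_projection Q T" and "S \<subseteq> T"
  shows "P (Q w) = P w" and "Q (P w) = P w"
proof -
  have "P (w - Q w) = 0"
    using orth_projectionD(5)[OF Q] \<open>S \<subseteq> T\<close> by (intro orth_projection_orthogonal[OF P]) blast
  moreover have "P (w - Q w) = P w - P (Q w)"
    using orth_projectionD(2)[OF P] by (rule linear_diff)
  ultimately show "P (Q w) = P w" by simp
  show "Q (P w) = P w"
    using \<open>S \<subseteq> T\<close> orth_projectionD(3)[OF P] orth_projectionD(4)[OF Q] by blast
qed

section \<open>The derivative of a metric projection on its set\<close>

lemma proj_well_definedD:
  assumes "proj_well_defined D y"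
  shows "closest_point D y \<in> D" "\<And>w. w \<in> D \<Longrightarrow> dist y (closest_point D y) \<le> dist y w"
    "infdist y D = norm (y - closest_point D y)"
proof -
  have ex: "\<exists>z\<in>D. \<forall>w\<in>D. dist y z \<le> dist y w"
    using assms unfolding proj_well_defined_def by blast
  have z: "closest_point D y \<in> D \<and> (\<forall>w\<in>D. dist y (closest_point D y) \<le> dist y w)"
    unfolding closest_point_def by (rule someI_ex) (use ex in blast)
  then show "closest_point D y \<in> D" "\<And>w. w \<in> D \<Longrightarrow> dist y (closest_point D y) \<le> dist y w"
    by auto
  show "infdist y D = norm (y - closest_point D y)"
    by (rule infdist_eq_norm_closest_point[OF ex])
qed

text \<open>
  This turns an inequality between the norms of two curves that vanish at \<open>0\<close> into an inequality
  between the norms of their velocities.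
\<close>

lemma norm_difference_quotient_tendsto:
  fixes g :: "real \<Rightarrow> 'a::real_normed_vector"
  assumes "(g has_vector_derivative d) (at 0)" "g 0 = 0"
  shows "((\<lambda>t. norm (g t) / \<bar>t\<bar>) \<longlongrightarrow> norm d) (at 0)"
proof -
  have lim: "((\<lambda>t. norm (g t - t *\<^sub>R d) / \<bar>t\<bar>) \<longlongrightarrow> 0) (at 0)"
    using assms by (simp add: has_vector_derivative_def has_derivative_at)
  have "((\<lambda>t. norm (g t) / \<bar>t\<bar> - norm d) \<longlongrightarrow> 0) (at 0)"
  proof (rule Lim_null_comparison[OF _ lim])
    have "norm (norm (g t) / \<bar>t\<bar> - norm d) \<le> norm (g t - t *\<^sub>R d) / \<bar>t\<bar>" if "t \<noteq> 0" for t
    proof -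
      have "norm (g t) / \<bar>t\<bar> - norm d = (norm (g t) - norm (t *\<^sub>R d)) / \<bar>t\<bar>"
        using that by (simp add: field_simps)
      then show ?thesis
        using norm_triangle_ineq3[of "g t" "t *\<^sub>R d"] by (simp add: divide_right_mono)
    qed
    then show "\<forall>\<^sub>F t in at 0. norm (norm (g t) / \<bar>t\<bar> - norm d) \<le> norm (g t - t *\<^sub>R d) / \<bar>t\<bar>"
      by (simp add: eventually_at_filter)
  qed
  then show ?thesis by (simp add: LIM_zero_iff)
qed

text \<open>
  Let \<open>Q\<close> be the derivative at \<open>x \<in> D\<close>. Differentiating \<open>P (c t) = c t\<close> along a curve \<open>c\<close> in \<open>D\<close>
  shows that \<open>Q\<close> fixes tangent vectors, and the curves \<open>P (x + t v)\<close> in \<open>D\<close> show that its values are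
  tangent. Hence the tangent space is the range of \<open>Q\<close>, a linear subspace. That
  \<open>Q\<close> is orthogonal comes from minimality: \<open>P (x + t w)\<close> is at least as close to \<open>x + t w\<close> as
  the point \<open>P (x + t v)\<close> of \<open>D\<close>, and dividing by \<open>t\<close> gives
  \<open>norm (w - Q w) \<le> norm (w - Q v)\<close>, so that \<open>Q w\<close> is the point of the range closest to \<open>w\<close>.
\<close>

lemma has_derivative_closest_point:
  fixes D U :: "'a::euclidean_space set"
  assumes U: "open U" "x \<in> U" and x: "x \<in> D"
    and wd: "\<And>y. y \<in> U \<Longrightarrow> proj_well_defined D y" and C1: "Ck_on 1 U (closest_point D)"
  obtains Q where "(closest_point D has_derivative Q) (at x)" "orth_projection Q (tangent_space D x)"
proof -
  let ?P = "closest_point D"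
  define Q where "Q = frechet_derivative ?P (at x)"
  have Q: "(?P has_derivative Q) (at x)"
    unfolding Q_def by (rule has_derivative_frechet_derivative[OF C1 U(2)])
  then have bl: "bounded_linear Q" and lin: "linear Q"
    by (auto simp: has_derivative_bounded_linear bounded_linear.linear)
  have Px: "?P x = x" using x by (rule closest_point_self)
  have contP: "continuous_on U (\<lambda>z. frechet_derivative ?P (at z) v)" for v
    using C1 unfolding Ck_on_1_iff by blast
  have line: "((\<lambda>t. ?P (x + t *\<^sub>R v)) has_vector_derivative Q v) (at 0)" for v
  proof -
    have "((\<lambda>t::real. x + t *\<^sub>R v) has_derivative (\<lambda>t. t *\<^sub>R v)) (at 0)"
      by (auto intro!: derivative_eq_intros)
    from has_derivative_compose[OF this, of ?P Q] Q show ?thesis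
      by (simp add: has_vector_derivative_def linear_scale[OF lin])
  qed
  have near: "\<exists>e>0. \<forall>t\<in>{-e<..<e}. x + t *\<^sub>R v \<in> U" for v
  proof -
    have "open ((\<lambda>t::real. x + t *\<^sub>R v) -` U)"
      using U(1) by (intro open_vimage continuous_intros)
    then obtain e where "e > 0" "ball 0 e \<subseteq> (\<lambda>t::real. x + t *\<^sub>R v) -` U"
      using U(2) open_contains_ball_eq[of "(\<lambda>t::real. x + t *\<^sub>R v) -` U" 0] by auto
    then show ?thesis by (intro exI[of _ e]) (auto simp: subset_iff)
  qed
  have fixed: "Q v = v" if tan: "v \<in> tangent_space D x" for v
  proof -
    obtain e c where e: "e > 0" "c ` {-e<..<e::real} \<subseteq> D" "c 0 = x"
      and c: "(c has_vector_derivative v) (at 0)"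
      using tan unfolding tangent_space_def by blast
    have "((\<lambda>t. ?P (c t)) has_derivative (\<lambda>t. Q (t *\<^sub>R v))) (at 0)"
      using has_derivative_compose[of c "\<lambda>t. t *\<^sub>R v" 0 UNIV ?P Q] c Q e(3)
      by (simp add: has_vector_derivative_def)
    then have "(c has_derivative (\<lambda>t. Q (t *\<^sub>R v))) (at 0)"
      by (rule has_derivative_transform_within_open[where s = "{-e<..<e}"])
        (use e in \<open>auto intro!: closest_point_self\<close>)
    then have "(\<lambda>t. Q (t *\<^sub>R v)) = (\<lambda>t. t *\<^sub>R v)"
      using c unfolding has_vector_derivative_def by (rule has_derivative_unique)
    from fun_cong[OF this, of 1] show ?thesis by simp
  qed
  have tan: "Q v \<in> tangent_space D x" for v
  proof -
    obtain e where e: "e > 0" "\<And>t. t \<in> {-e<..<e} \<Longrightarrow> x + t *\<^sub>R v \<in> U" using near by blast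
    let ?c = "\<lambda>t. ?P (x + t *\<^sub>R v)"
    have "Ck_on 1 {-e<..<e} ?c"
    proof (rule Ck_on_1I[where f' = "\<lambda>t s. s *\<^sub>R frechet_derivative ?P (at (x + t *\<^sub>R v)) v"])
      fix t assume "t \<in> {-e<..<e}"
      then have d: "(?P has_derivative frechet_derivative ?P (at (x + t *\<^sub>R v))) (at (x + t *\<^sub>R v))"
        by (intro has_derivative_frechet_derivative[OF C1] e)
      have "((\<lambda>t::real. x + t *\<^sub>R v) has_derivative (\<lambda>s. s *\<^sub>R v)) (at t)"
        by (auto intro!: derivative_eq_intros)
      from has_derivative_compose[OF this d]
      show "(?c has_derivative (\<lambda>s. s *\<^sub>R frechet_derivative ?P (at (x + t *\<^sub>R v)) v)) (at t)"
        using d by (simp add: linear_scale[OF bounded_linear.linear[OF has_derivative_bounded_linear]])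
    next
      fix s :: real
      have "continuous_on {-e<..<e} (\<lambda>t. frechet_derivative ?P (at (x + t *\<^sub>R v)) v)"
        by (rule continuous_on_compose2[of U "\<lambda>z. frechet_derivative ?P (at z) v"])
          (use e contP in \<open>auto intro!: continuous_intros\<close>)
      then show "continuous_on {-e<..<e} (\<lambda>t. s *\<^sub>R frechet_derivative ?P (at (x + t *\<^sub>R v)) v)"
        by (intro continuous_intros)
    qed
    moreover have "?c ` {-e<..<e} \<subseteq> D"
      using e(2) proj_well_definedD(1)[OF wd] by auto
    ultimately show ?thesis
      unfolding tangent_space_def using e(1) Px line[of v] by fastforce
  qed
  have range: "range Q = tangent_space D x"
  proof
    show "tangent_space D x \<subseteq> range Q" by (metis fixed rangeI subsetI)
  qed (use tan in auto)
  have minimal: "norm (w - Q w) \<le> norm (w - Q v)" for v w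
  proof -
    obtain e1 where e1: "e1 > 0" "\<And>t. t \<in> {-e1<..<e1} \<Longrightarrow> x + t *\<^sub>R v \<in> U" using near by blast
    obtain e2 where e2: "e2 > 0" "\<And>t. t \<in> {-e2<..<e2} \<Longrightarrow> x + t *\<^sub>R w \<in> U" using near by blast
    have lim: "((\<lambda>t. norm (x + t *\<^sub>R w - ?P (x + t *\<^sub>R u)) / \<bar>t\<bar>) \<longlongrightarrow> norm (w - Q u)) (at 0)" for u
    proof (rule norm_difference_quotient_tendsto)
      have "((\<lambda>t::real. x + t *\<^sub>R w) has_vector_derivative w) (at 0)"
        by (auto intro!: derivative_eq_intros simp: has_vector_derivative_def)
      then show "((\<lambda>t. x + t *\<^sub>R w - ?P (x + t *\<^sub>R u)) has_vector_derivative w - Q u) (at 0)"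
        by (rule has_vector_derivative_diff[OF _ line])
    qed (simp add: Px)
    have "norm (x + t *\<^sub>R w - ?P (x + t *\<^sub>R w)) / \<bar>t\<bar> \<le> norm (x + t *\<^sub>R w - ?P (x + t *\<^sub>R v)) / \<bar>t\<bar>"
      if "\<bar>t\<bar> < min e1 e2" for t
    proof (rule divide_right_mono)
      have "?P (x + t *\<^sub>R v) \<in> D" "x + t *\<^sub>R w \<in> U"
        using that e1(2)[of t] e2(2)[of t] proj_well_definedD(1)[OF wd] by (auto simp: abs_less_iff)
      from proj_well_definedD(2)[OF wd[OF this(2)] this(1)]
      show "norm (x + t *\<^sub>R w - ?P (x + t *\<^sub>R w)) \<le> norm (x + t *\<^sub>R w - ?P (x + t *\<^sub>R v))"
        by (simp add: dist_norm)
    qed simp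
    moreover have "min e1 e2 > 0" using e1 e2 by simp
    ultimately have "\<forall>\<^sub>F t in at 0. norm (x + t *\<^sub>R w - ?P (x + t *\<^sub>R w)) / \<bar>t\<bar>
        \<le> norm (x + t *\<^sub>R w - ?P (x + t *\<^sub>R v)) / \<bar>t\<bar>"
      unfolding eventually_at by (intro exI[of _ "min e1 e2"]) (auto simp: dist_real_def)
    then show ?thesis
      by (rule tendsto_le[OF _ lim lim, rotated]) simp
  qed
  have orth: "(w - Q w) \<bullet> Q v = 0" for v w
  proof -
    have sub: "subspace (range Q)" using lin by (rule linear_subspace_image) simp
    have "(w - Q w) \<bullet> (Q u - Q w) \<le> 0" for u
      by (rule any_closest_point_dot[of "range Q"])
        (use sub minimal in \<open>auto simp: subspace_imp_convex closed_subspace dist_norm\<close>)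
    from this[of "w + v"] this[of "w - v"] show ?thesis
      by (simp add: linear_add[OF lin] linear_diff[OF lin])
  qed
  have "orth_projection Q (tangent_space D x)"
    unfolding orth_projection_def using bl range fixed orth by force
  with Q show ?thesis by (rule that)
qed

text \<open>
  The distance to \<open>D\<close> is at most the distance to \<open>x \<in> D\<close>, so the two maps differ by \<open>o(norm (y - x))\<close>.
  The little-o refers to the punctured filter at \<open>x\<close> and says nothing about the value at \<open>x\<close> itself;
  that value is recovered by continuity.
\<close>

lemma first_order_consistent_has_derivative:
  fixes D V :: "'a::euclidean_space set"
  assumes con: "first_order_consistent D \<phi> V" and x: "x \<in> V" "x \<in> D"
    and cont: "isCont \<phi> x" and P: "(closest_point D has_derivative Q) (at x)"
  shows "\<phi> x = x" and "(\<phi> has_derivative Q) (at x)"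
proof -
  let ?P = "closest_point D"
  have Px: "?P x = x" using x by (simp add: closest_point_self)
  have small: "\<forall>\<^sub>F y in at x. norm (\<phi> y - ?P y) \<le> c * norm (y - x)" if "c > 0" for c
  proof -
    have "(\<lambda>y. norm (\<phi> y - ?P y)) \<in> o[at x](\<lambda>y. infdist y D)"
      using con x unfolding first_order_consistent_def by blast
    from landau_o.smallD[OF this that] show ?thesis
    proof eventually_elim
      case (elim y)
      have "infdist y D \<le> norm (y - x)" using infdist_le[OF x(2), of y] by (simp add: dist_norm)
      with that have "c * infdist y D \<le> c * norm (y - x)" by simp
      with elim show ?case by (simp add: infdist_nonneg)
    qed
  qed
  have "((\<lambda>y. \<phi> y - ?P y) \<longlongrightarrow> 0) (at x)"
  proof (rule Lim_null_comparison)
    show "\<forall>\<^sub>F y in at x. norm (\<phi> y - ?P y) \<le> 1 * norm (y - x)" by (rule small) simp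
    show "((\<lambda>y. 1 * norm (y - x)) \<longlongrightarrow> 0) (at x)"
      by (rule tendsto_eq_intros | simp)+
  qed
  moreover have "((\<lambda>y. \<phi> y - ?P y) \<longlongrightarrow> \<phi> x - ?P x) (at x)"
    using cont has_derivative_continuous[OF P] by (intro tendsto_diff) (auto simp: isCont_def)
  ultimately have "\<phi> x - ?P x = 0" using LIM_unique by blast
  then show fx: "\<phi> x = x" using Px by simp
  have "((\<lambda>y. \<phi> y - ?P y) has_derivative (\<lambda>_. 0)) (at x)"
    unfolding has_derivative_iff_norm
  proof (intro conjI tendstoI)
    fix e :: real assume "e > 0"
    then have "\<forall>\<^sub>F y in at x. norm (\<phi> y - ?P y) \<le> e/2 * norm (y - x)" by (intro small) simp
    moreover have "\<forall>\<^sub>F y in at x. y \<noteq> x" by (simp add: eventually_at_filter)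
    ultimately show "\<forall>\<^sub>F y in at x.
        dist (norm (\<phi> y - ?P y - (\<phi> x - ?P x) - 0) / norm (y - x)) 0 < e"
    proof eventually_elim
      case (elim y)
      then have "norm (\<phi> y - ?P y) < e * norm (y - x)"
        using \<open>e > 0\<close> by (smt (verit) mult_strict_right_mono field_sum_of_halves zero_less_norm_iff right_minus_eq)
      with elim show ?case by (simp add: fx Px divide_less_eq)
    qed
  qed simp
  from has_derivative_add[OF this P] show "(\<phi> has_derivative Q) (at x)" by simp
qed

section \<open>Geometric convergence\<close>

lemma geometric_steps_limit:
  fixes X :: "nat \<Rightarrow> 'a::banach"
  assumes \<theta>: "0 < \<theta>" "\<theta> < 1" and step: "\<And>k. norm (X (Suc k) - X k) \<le> C * \<theta> ^ k"
  shows "X \<longlonglongrightarrow> lim X" and "norm (X k - lim X) \<le> C / (1 - \<theta>) * \<theta> ^ k"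
proof -
  have C: "C \<ge> 0" using order_trans[OF norm_ge_zero step[of 0]] by simp
  have "summable (\<lambda>k. X (Suc k) - X k)"
    by (rule summable_comparison_test[OF _ summable_mult[of "\<lambda>k. \<theta> ^ k" C]])
      (use step \<theta> in \<open>auto intro!: summable_geometric\<close>)
  then have "convergent (\<lambda>n. \<Sum>k<n. X (Suc k) - X k)"
    by (simp add: summable_iff_convergent)
  then obtain l where "(\<lambda>n. X n - X 0) \<longlonglongrightarrow> l"
    unfolding convergent_def sum_lessThan_telescope by blast
  from tendsto_add[OF this tendsto_const[of "X 0"]] have "X \<longlonglongrightarrow> l + X 0" by simp
  then show lim: "X \<longlonglongrightarrow> lim X" by (simp add: limI)
  have dist: "norm (X (k + j) - X k) \<le> C / (1 - \<theta>) * \<theta> ^ k * (1 - \<theta> ^ j)" for j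
  proof (induction j)
    case (Suc j)
    have "norm (X (k + Suc j) - X k) \<le> norm (X (Suc (k + j)) - X (k + j)) + norm (X (k + j) - X k)"
      using norm_triangle_ineq[of "X (Suc (k + j)) - X (k + j)" "X (k + j) - X k"] by simp
    also have "\<dots> \<le> C * \<theta> ^ (k + j) + C / (1 - \<theta>) * \<theta> ^ k * (1 - \<theta> ^ j)"
      by (intro add_mono step Suc.IH)
    also have "\<dots> = C / (1 - \<theta>) * \<theta> ^ k * (1 - \<theta> ^ Suc j)"
      using \<theta> by (simp add: field_simps power_add)
    finally show ?case .
  qed simp
  have "norm (X (k + j) - X k) \<le> C / (1 - \<theta>) * \<theta> ^ k" for j
  proof -
    have "C / (1 - \<theta>) * \<theta> ^ k * (1 - \<theta> ^ j) \<le> C / (1 - \<theta>) * \<theta> ^ k * 1"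
      using \<theta> C by (intro mult_left_mono) auto
    with dist[of j] show ?thesis by simp
  qed
  moreover have "(\<lambda>j. norm (X (k + j) - X k)) \<longlonglongrightarrow> norm (lim X - X k)"
    using LIMSEQ_ignore_initial_segment[OF lim, of k] by (intro tendsto_intros) (simp add: add.commute)
  ultimately have "norm (lim X - X k) \<le> C / (1 - \<theta>) * \<theta> ^ k"
    by (intro LIMSEQ_le_const2[OF _ exI[of _ 0]]) auto
  then show "norm (X k - lim X) \<le> C / (1 - \<theta>) * \<theta> ^ k" by (simp add: norm_minus_commute)
qed

text \<open>
  Products of operators that tend geometrically to \<open>A'\<close>, where \<open>A'\<close> is the identity on the range of a
  projection \<open>P\<close> and a contraction, by the factor \<open>c\<close>, on the complement. The products are bounded by
  \<open>\<beta>\<close> since \<open>norm (A k) \<le> 1 + a \<tau>\<^sup>k \<le> exp (a \<tau>\<^sup>k)\<close>. Because \<open>P A' = P\<close>, the component \<open>P B\<^sub>k\<close>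
  changes by \<open>P (A\<^sub>k - A') B\<^sub>k\<close> only, of order \<open>\<tau>\<^sup>k\<close>. The component \<open>B\<^sub>k - P B\<^sub>k\<close> is multiplied by
  \<open>A' - P\<close> up to an error of order \<open>\<tau>\<^sup>k\<close>, hence decays at every rate \<open>\<theta> \<ge> \<tau>\<close> with \<open>c < \<theta>\<close>. The
  constants \<open>N\<close> and \<open>\<theta>\<close> are explicit in \<open>a\<close>, \<open>\<tau>\<close>, \<open>c\<close> in order to be uniform over all starting points
  of an orbit.
\<close>

lemma operator_products_geometric:
  fixes A B :: "nat \<Rightarrow> 'a::banach \<Rightarrow>\<^sub>L 'a" and A' P :: "'a \<Rightarrow>\<^sub>L 'a" and a \<tau> c :: real
  defines "\<theta> \<equiv> max \<tau> ((1 + c) / 2)" and "\<beta> \<equiv> exp (a / (1 - \<tau>))"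
  defines "N \<equiv> 2 * (2 * a * \<beta> / (\<theta> - c) + 2) + a * \<beta>"
  assumes a: "0 \<le> a" and \<tau>: "0 < \<tau>" "\<tau> < 1" and c: "0 \<le> c" "c < 1"
    and B0: "B 0 = id_blinfun" and BS: "\<And>k. B (Suc k) = A k o\<^sub>L B k"
    and A: "\<And>k. norm (A k - A') \<le> a * \<tau> ^ k" and A': "norm A' \<le> 1" and P: "norm P \<le> 1"
    and AP: "norm (A' - P) \<le> c"
    and eqs: "\<And>v. A' (P v) = P v" "\<And>v. P (A' v) = P v" "\<And>v. P (P v) = P v"
  shows "norm (B (Suc k) - B k) \<le> N * \<theta> ^ k" and "norm (B k - (P o\<^sub>L B k)) \<le> N * \<theta> ^ k"
proof -
  define N' where "N' = 2 * a * \<beta> / (\<theta> - c) + 2"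
  have \<theta>: "0 < \<theta>" "\<theta> < 1" "\<tau> \<le> \<theta>" "c < \<theta>"
    using \<tau> c by (auto simp: \<theta>_def max_def field_simps)
  have \<beta>: "\<beta> \<ge> 1" using a \<tau> by (simp add: \<beta>_def)
  have N': "N' \<ge> 2" "2 * a * \<beta> \<le> N' * (\<theta> - c)"
  proof -
    show "N' \<ge> 2" using a \<beta> \<theta> by (simp add: N'_def)
    have "N' * (\<theta> - c) = 2 * a * \<beta> + 2 * (\<theta> - c)"
      using \<theta> by (simp add: N'_def distrib_right)
    then show "2 * a * \<beta> \<le> N' * (\<theta> - c)" using \<theta> by simp
  qed
  have a\<beta>: "a * \<beta> \<ge> 0" using a \<beta> by simp
  have powle: "\<tau> ^ k \<le> \<theta> ^ k" for k using \<tau> \<theta> by (intro power_mono) auto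
  have nA: "norm (A k) \<le> exp (a * \<tau> ^ k)" for k
  proof -
    have "norm (A k) \<le> 1 + a * \<tau> ^ k"
      using norm_triangle_ineq[of "A k - A'" A'] A[of k] A' by simp
    also have "\<dots> \<le> exp (a * \<tau> ^ k)" by (rule exp_ge_add_one_self)
    finally show ?thesis .
  qed
  have nB: "norm (B k) \<le> \<beta>" for k
  proof -
    have "norm (B k) \<le> exp (a * (\<Sum>j<k. \<tau> ^ j))"
    proof (induction k)
      case 0
      show ?case by (simp add: B0 norm_blinfun_id_le)
    next
      case (Suc k)
      have "norm (B (Suc k)) \<le> norm (A k) * norm (B k)"
        unfolding BS by (rule norm_blinfun_compose)
      also have "\<dots> \<le> exp (a * \<tau> ^ k) * exp (a * (\<Sum>j<k. \<tau> ^ j))"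
        by (intro mult_mono nA Suc.IH) auto
      finally show ?case by (simp add: exp_add[symmetric] algebra_simps)
    qed
    also have "\<dots> \<le> \<beta>"
    proof -
      have "(\<Sum>j<k. \<tau> ^ j) = (1 - \<tau> ^ k) / (1 - \<tau>)" using \<tau> by (simp add: sum_gp_strict)
      also have "\<dots> \<le> 1 / (1 - \<tau>)" using \<tau> by (intro divide_right_mono) auto
      finally have "a * (\<Sum>j<k. \<tau> ^ j) \<le> a * (1 / (1 - \<tau>))" using a by (intro mult_left_mono)
      then show ?thesis by (simp add: \<beta>_def)
    qed
    finally show ?thesis .
  qed
  have nD: "norm ((A k - A') o\<^sub>L B k) \<le> a * \<beta> * \<theta> ^ k" for k
  proof -
    have "norm ((A k - A') o\<^sub>L B k) \<le> norm (A k - A') * norm (B k)" by (rule norm_blinfun_compose)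
    also have "\<dots> \<le> (a * \<theta> ^ k) * \<beta>"
      using order_trans[OF A mult_left_mono[OF powle a]] nB \<theta> a by (intro mult_mono) auto
    finally show ?thesis by (simp add: algebra_simps)
  qed
  have nP: "norm (P o\<^sub>L W) \<le> norm W" for W :: "'a \<Rightarrow>\<^sub>L 'a"
    using norm_blinfun_compose[of P W] mult_right_mono[OF P, of "norm W"] by simp
  have R: "norm (B k - (P o\<^sub>L B k)) \<le> N' * \<theta> ^ k" for k
  proof (induction k)
    case 0
    have "norm (B 0 - (P o\<^sub>L B 0)) \<le> norm (B 0) + norm (B 0)"
      using norm_triangle_ineq4[of "B 0" "P o\<^sub>L B 0"] nP[of "B 0"] by simp
    also have "\<dots> \<le> 2" using norm_blinfun_id_le[where ?'a = 'a] by (simp add: B0)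
    finally show ?case using N' by simp
  next
    case (Suc k)
    let ?D = "(A k - A') o\<^sub>L B k"
    \<comment> \<open>\<open>(A' - P) P = 0\<close> and \<open>P A' = P\<close> turn the recursion for \<open>B\<close> into one for the complement.\<close>
    have "B (Suc k) - (P o\<^sub>L B (Suc k)) = ((A' - P) o\<^sub>L (B k - (P o\<^sub>L B k))) + (?D - (P o\<^sub>L ?D))"
      by (rule blinfun_eqI) (simp add: BS blinfun.bilinear_simps eqs)
    also have "norm \<dots> \<le> norm (A' - P) * norm (B k - (P o\<^sub>L B k)) + (norm ?D + norm (P o\<^sub>L ?D))"
      by (intro norm_triangle_mono norm_blinfun_compose norm_triangle_ineq4)
    also have "\<dots> \<le> c * (N' * \<theta> ^ k) + (a * \<beta> * \<theta> ^ k + a * \<beta> * \<theta> ^ k)"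
      using Suc.IH AP c nD[of k] nP[of ?D] by (intro add_mono mult_mono) auto
    also have "\<dots> = (c * N' + 2 * a * \<beta>) * \<theta> ^ k" by (simp add: algebra_simps)
    also have "\<dots> \<le> (N' * \<theta>) * \<theta> ^ k"
      using N'(2) \<theta> by (intro mult_right_mono) (auto simp: algebra_simps)
    finally show ?case by (simp add: algebra_simps)
  qed
  have N'_le: "N' * \<theta> ^ k \<le> (2 * N' + a * \<beta>) * \<theta> ^ k"
    using N' a \<beta> \<theta> by (intro mult_right_mono) auto
  let ?D = "(A k - A') o\<^sub>L B k"
  have "B (Suc k) - B k = (B (Suc k) - (P o\<^sub>L B (Suc k))) - (B k - (P o\<^sub>L B k)) + (P o\<^sub>L ?D)"
    by (rule blinfun_eqI) (simp add: BS blinfun.bilinear_simps eqs)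
  also have "norm \<dots> \<le> (N' * \<theta> ^ Suc k + N' * \<theta> ^ k) + a * \<beta> * \<theta> ^ k"
    using norm_triangle_ineq4[of "B (Suc k) - (P o\<^sub>L B (Suc k))" "B k - (P o\<^sub>L B k)"]
      R[of "Suc k"] R[of k] order_trans[OF nP nD[of k]]
    by (intro norm_triangle_mono) auto
  also have "\<dots> \<le> (N' * \<theta> ^ k + N' * \<theta> ^ k) + a * \<beta> * \<theta> ^ k"
    using N' \<theta> a\<beta> by (intro add_mono mult_left_mono) (auto simp: mult_le_cancel_right1)
  finally have "norm (B (Suc k) - B k) \<le> (2 * N' + a * \<beta>) * \<theta> ^ k" by (simp add: algebra_simps)
  with R[of k] N'_le
  show "norm (B (Suc k) - B k) \<le> N * \<theta> ^ k" "norm (B k - (P o\<^sub>L B k)) \<le> N * \<theta> ^ k"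
    by (simp_all add: N_def N'_def)
qed

section \<open>Differentiability of the limit of an iteration\<close>

primrec orbit_derivative ::
    "('a \<Rightarrow> 'a) \<Rightarrow> ('a \<Rightarrow> 'a \<Rightarrow>\<^sub>L 'a) \<Rightarrow> nat \<Rightarrow> 'a \<Rightarrow> 'a::real_normed_vector \<Rightarrow>\<^sub>L 'a" where
  "orbit_derivative f f' 0 y = id_blinfun"
| "orbit_derivative f f' (Suc k) y = f' ((f ^^ k) y) o\<^sub>L orbit_derivative f f' k y"

lemma funpow_has_derivative_orbit_derivative:
  assumes "\<And>k. (f ^^ k) y \<in> B" "\<And>y. y \<in> B \<Longrightarrow> (f has_derivative blinfun_apply (f' y)) (at y)"
  shows "((f ^^ k) has_derivative blinfun_apply (orbit_derivative f f' k y)) (at y)"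
proof (induction k)
  case 0
  show ?case by (simp add: id_def)
next
  case (Suc k)
  from has_derivative_compose[OF Suc.IH assms(2)[OF assms(1)]]
  show ?case by (simp add: o_def blinfun_compose.rep_eq)
qed

text \<open>
  \<open>F\<close> is the set of possible limits, and \<open>P z\<close> is the neutral part of \<open>f' z\<close> for \<open>z \<in> F\<close>. The orbit of
  \<open>y\<close> approaches its limit at a rate independent of \<open>y\<close>, so do the derivatives along the orbit, and the
  product estimate applies with constants independent of \<open>y\<close>. Thus the derivatives of \<open>f\<^sup>k\<close> converge
  uniformly on \<open>S\<close>. At a fixed point all factors of the product agree, and \<open>P z\<close> times any of the
  products is \<open>P z\<close>, which identifies the limit.
\<close>

lemma iteration_limit_C1:
  fixes f :: "'a::euclidean_space \<Rightarrow> 'a" and f' P :: "'a \<Rightarrow> 'a \<Rightarrow>\<^sub>L 'a"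
  assumes S: "open S" "convex S"
    and orbit: "\<And>y k. y \<in> S \<Longrightarrow> (f ^^ k) y \<in> B"
    and der: "\<And>y. y \<in> B \<Longrightarrow> (f has_derivative blinfun_apply (f' y)) (at y)"
    and lip: "L-lipschitz_on B f'"
    and \<tau>: "0 < \<tau>" "\<tau> < 1" and C: "0 \<le> C"
    and step: "\<And>y k. y \<in> S \<Longrightarrow> norm ((f ^^ Suc k) y - (f ^^ k) y) \<le> C * \<tau> ^ k"
    and lim_in: "\<And>y. y \<in> S \<Longrightarrow> lim (\<lambda>k. (f ^^ k) y) \<in> F" and F: "F \<subseteq> B"
    and norms: "\<And>z. z \<in> F \<Longrightarrow> norm (f' z) \<le> 1" "\<And>z. z \<in> F \<Longrightarrow> norm (P z) \<le> 1"
      "\<And>z. z \<in> F \<Longrightarrow> norm (f' z - P z) \<le> c" and c: "c < 1"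
    and eqs: "\<And>z v. z \<in> F \<Longrightarrow> f' z (P z v) = P z v" "\<And>z v. z \<in> F \<Longrightarrow> P z (f' z v) = P z v"
      "\<And>z v. z \<in> F \<Longrightarrow> P z (P z v) = P z v"
  obtains G where
    "\<And>y. y \<in> S \<Longrightarrow> ((\<lambda>y. lim (\<lambda>k. (f ^^ k) y)) has_derivative blinfun_apply (G y)) (at y)"
    "continuous_on S G" "\<And>z. z \<in> S \<Longrightarrow> z \<in> F \<Longrightarrow> f z = z \<Longrightarrow> G z = P z"
proof (cases "S = {}")
  case True
  then show ?thesis using that by auto
next
  case False
  then obtain y0 where y0: "y0 \<in> S" by blast
  let ?\<Psi> = "\<lambda>y. lim (\<lambda>k. (f ^^ k) y)"
  let ?J = "orbit_derivative f f'"
  define a where "a = L * (C / (1 - \<tau>))"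
  have "L \<ge> 0" by (rule lipschitz_on_nonneg[OF lip])
  then have a: "a \<ge> 0" using C \<tau> by (simp add: a_def)
  have c0: "c \<ge> 0" using norms(3)[OF lim_in[OF y0]] order_trans[OF norm_ge_zero] by blast
  define \<theta> where "\<theta> = max \<tau> ((1 + c) / 2)"
  define \<beta> where "\<beta> = exp (a / (1 - \<tau>))"
  define N where "N = 2 * (2 * a * \<beta> / (\<theta> - c) + 2) + a * \<beta>"
  have \<theta>: "0 < \<theta>" "\<theta> < 1" using \<tau> c c0 by (auto simp: \<theta>_def)
  have conv: "(\<lambda>k. (f ^^ k) y) \<longlonglongrightarrow> ?\<Psi> y" if "y \<in> S" for y
    by (rule geometric_steps_limit(1)[OF \<tau> step[OF that]])
  have J: "norm (?J (Suc k) y - ?J k y) \<le> N * \<theta> ^ k \<and>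
      norm (?J k y - (P (?\<Psi> y) o\<^sub>L ?J k y)) \<le> N * \<theta> ^ k" if y: "y \<in> S" for y k
  proof -
    let ?A = "\<lambda>k. f' ((f ^^ k) y)"
    note z = lim_in[OF y]
    have dist: "norm (?A k - f' (?\<Psi> y)) \<le> a * \<tau> ^ k" for k
    proof -
      have "norm (f' ((f ^^ k) y) - f' (?\<Psi> y)) \<le> L * norm ((f ^^ k) y - ?\<Psi> y)"
        using lipschitz_onD[OF lip orbit[OF y, of k]] lim_in[OF y] F by (auto simp: dist_norm)
      also have "\<dots> \<le> L * (C / (1 - \<tau>) * \<tau> ^ k)"
        by (intro mult_left_mono geometric_steps_limit(2)[OF \<tau> step[OF y]] \<open>L \<ge> 0\<close>)
      finally show ?thesis by (simp add: a_def)
    qed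
    note prod = operator_products_geometric[of a \<tau> c "\<lambda>k. ?J k y" ?A "f' (?\<Psi> y)" "P (?\<Psi> y)" k,
        folded \<theta>_def \<beta>_def, OF a \<tau> c0 c orbit_derivative.simps dist norms(1)[OF z] norms(2)[OF z]
        norms(3)[OF z] eqs(1)[OF z] eqs(2)[OF z] eqs(3)[OF z]]
    show ?thesis using prod unfolding N_def by blast
  qed
  define G where "G y = lim (\<lambda>k. ?J k y)" for y
  have rate: "norm (?J k y - G y) \<le> N / (1 - \<theta>) * \<theta> ^ k" if "y \<in> S" for y k
    unfolding G_def by (rule geometric_steps_limit(2)[OF \<theta>]) (use J[OF that] in blast)
  have small: "\<forall>\<^sub>F k in sequentially. N / (1 - \<theta>) * \<theta> ^ k < e" if "e > 0" for e
  proof (rule order_tendstoD(2)[OF _ that])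
    have "(\<lambda>k. N / (1 - \<theta>) * \<theta> ^ k) \<longlonglongrightarrow> N / (1 - \<theta>) * 0"
      using \<theta> by (intro tendsto_intros LIMSEQ_power_zero) auto
    then show "(\<lambda>k. N / (1 - \<theta>) * \<theta> ^ k) \<longlonglongrightarrow> 0" by simp
  qed
  have derk: "((f ^^ k) has_derivative blinfun_apply (?J k y)) (at y)" if "y \<in> S" for y k
    by (rule funpow_has_derivative_orbit_derivative[where B = B]) (use orbit[OF that] der in auto)
  have "\<exists>g. \<forall>y\<in>S. (\<lambda>k. (f ^^ k) y) \<longlonglongrightarrow> g y \<and> (g has_derivative blinfun_apply (G y)) (at y within S)"
  proof (rule has_derivative_sequence[where f = "\<lambda>k. f ^^ k" and f' = "\<lambda>k y. blinfun_apply (?J k y)",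
        OF S(2) _ _ y0 conv[OF y0]])
    show "((f ^^ k) has_derivative blinfun_apply (?J k y)) (at y within S)" if "y \<in> S" for y k
      using derk[OF that] by (rule has_derivative_at_withinI)
    fix e :: real assume "e > 0"
    from small[OF this]
    show "\<forall>\<^sub>F k in sequentially. \<forall>y\<in>S. \<forall>h. norm (?J k y h - G y h) \<le> e * norm h"
    proof eventually_elim
      case (elim k)
      show ?case
      proof (intro ballI allI)
        fix y h assume "y \<in> S"
        have "norm ((?J k y - G y) h) \<le> norm (?J k y - G y) * norm h" by (rule norm_blinfun)
        also have "\<dots> \<le> e * norm h"
          using rate[OF \<open>y \<in> S\<close>, of k] elim by (intro mult_right_mono) auto
        finally show "norm (?J k y h - G y h) \<le> e * norm h" by (simp add: blinfun.diff_left)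
      qed
    qed
  qed
  then obtain g where g: "\<And>y. y \<in> S \<Longrightarrow> (\<lambda>k. (f ^^ k) y) \<longlonglongrightarrow> g y"
      "\<And>y. y \<in> S \<Longrightarrow> (g has_derivative blinfun_apply (G y)) (at y within S)" by blast
  have g_eq: "g y = ?\<Psi> y" if "y \<in> S" for y
    using LIMSEQ_unique[OF g(1) conv] that by blast
  show ?thesis
  proof (rule that[of G])
    fix y assume y: "y \<in> S"
    have "(g has_derivative blinfun_apply (G y)) (at y)"
      using g(2)[OF y] unfolding at_within_open[OF y S(1)] .
    then show "(?\<Psi> has_derivative blinfun_apply (G y)) (at y)"
      by (rule has_derivative_transform_within_open[OF _ S(1) y]) (rule g_eq)
  next
    have contJ: "continuous_on S (?J k)" for k
    proof (induction k)
      case (Suc k)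
      have "continuous_on S (f ^^ k)"
        by (intro continuous_at_imp_continuous_on ballI has_derivative_continuous[OF derk])
      then have "continuous_on S (\<lambda>y. f' ((f ^^ k) y))"
        by (rule continuous_on_compose2[OF lipschitz_on_continuous_on[OF lip]]) (use orbit in auto)
      then show ?case
        using Suc.IH by (simp add: bounded_bilinear.continuous_on[OF bounded_bilinear_blinfun_compose])
    qed simp
    have "uniform_limit S ?J G sequentially"
    proof (rule uniform_limitI)
      fix e :: real assume "e > 0"
      from small[OF this] show "\<forall>\<^sub>F k in sequentially. \<forall>y\<in>S. dist (?J k y) (G y) < e"
      proof eventually_elim
        case (elim k)
        show ?case
        proof
          fix y assume "y \<in> S"
          from rate[OF this, of k] elim show "dist (?J k y) (G y) < e" by (simp add: dist_norm)
        qed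
      qed
    qed
    then show "continuous_on S G"
      by (rule uniform_limit_theorem[rotated]) (simp_all add: contJ)
  next
    fix z assume z: "z \<in> S" "z \<in> F" "f z = z"
    have fix_orbit: "(f ^^ k) z = z" for k using z(3) by (induction k) auto
    then have \<Psi>z: "?\<Psi> z = z" by (simp add: limI)
    have PJ: "P z o\<^sub>L ?J k z = P z" for k
    proof (induction k)
      case (Suc k)
      have "P z o\<^sub>L ?J (Suc k) z = P z o\<^sub>L ?J k z"
        by (rule blinfun_eqI) (simp add: fix_orbit eqs z)
      with Suc.IH show ?case by simp
    qed (simp add: blinfun_eqI)
    have "(\<lambda>k. ?J k z - P z) \<longlonglongrightarrow> 0"
    proof (rule Lim_null_comparison)
      show "\<forall>\<^sub>F k in sequentially. norm (?J k z - P z) \<le> N * \<theta> ^ k"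
        using J[OF z(1)] by (simp add: \<Psi>z PJ)
      have "(\<lambda>k. N * \<theta> ^ k) \<longlonglongrightarrow> N * 0"
        using \<theta> by (intro tendsto_intros LIMSEQ_power_zero) auto
      then show "(\<lambda>k. N * \<theta> ^ k) \<longlonglongrightarrow> 0" by simp
    qed
    then have "(\<lambda>k. ?J k z) \<longlonglongrightarrow> P z" by (simp add: LIM_zero_iff)
    then show "G z = P z" unfolding G_def by (rule limI)
  qed
qed

text \<open>
  The first step brings the point into \<open>M\<close> at a distance of at most \<open>L r\<close> from \<open>x\<close>. From then on \<open>d\<close>, and
  with it the length of the steps, decreases like \<open>\<tau>\<^sup>k\<close>, so the orbit moves by at most
  \<open>a L r / (1 - \<tau>)\<close> in total. It remains in the ball if \<open>r (1 + L + a L / (1 - \<tau>)) \<le> R\<close>.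
\<close>

lemma contracting_orbits_stay:
  fixes f :: "'a::real_normed_vector \<Rightarrow> 'a" and d :: "'a \<Rightarrow> real"
  assumes R: "R > 0" and \<tau>: "0 < \<tau>" "\<tau> < 1" and L: "L \<ge> 0" and a: "a \<ge> 0"
    and f_in: "\<And>y. y \<in> ball x R \<Longrightarrow> f y \<in> M"
    and near: "\<And>y. y \<in> ball x R \<Longrightarrow> norm (f y - x) \<le> L * norm (y - x)"
    and contr: "\<And>y. y \<in> M \<Longrightarrow> y \<in> ball x R \<Longrightarrow> d (f y) \<le> \<tau> * d y"
    and move: "\<And>y. y \<in> M \<Longrightarrow> y \<in> ball x R \<Longrightarrow> norm (f y - y) \<le> a * d y"
    and d_le: "\<And>y. d y \<le> norm (y - x)"
  obtains r C where "r > 0" "C \<ge> 0" "\<And>y k. y \<in> ball x r \<Longrightarrow> (f ^^ k) y \<in> ball x R"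
    "\<And>y k. y \<in> ball x r \<Longrightarrow> norm ((f ^^ Suc k) y - (f ^^ k) y) \<le> C * \<tau> ^ k"
    "\<And>y k. y \<in> ball x r \<Longrightarrow> d ((f ^^ Suc k) y) \<le> C * \<tau> ^ k"
proof -
  define E where "E = 1 + L + a * L / (1 - \<tau>)"
  define r where "r = R / E"
  \<comment> \<open>The first summand bounds the step from the starting point, which may lie off \<open>M\<close>; the division
    by \<open>\<tau>\<close> in the second shifts the decay of the later steps by one index.\<close>
  define C where "C = (L + 1) * r + a * L * r / \<tau>"
  have E: "E \<ge> 1" using L a \<tau> by (simp add: E_def)
  then have r: "r > 0" "r \<le> R" "r * E = R"
    using R by (auto simp: r_def field_simps mult_le_cancel_left1)
  have C: "C \<ge> L * r" using L a \<tau> r by (simp add: C_def algebra_simps)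
  have orbit: "(f ^^ Suc k) y \<in> M \<and> (f ^^ Suc k) y \<in> ball x R \<and> d ((f ^^ Suc k) y) \<le> \<tau> ^ k * (L * r) \<and>
      norm ((f ^^ Suc k) y - f y) \<le> a * L * r * (1 - \<tau> ^ k) / (1 - \<tau>)" if y: "y \<in> ball x r" for y k
  proof -
    have yR: "y \<in> ball x R" using y r by auto
    have f1: "norm (f y - x) \<le> L * r"
    proof -
      have "norm (y - x) \<le> r" using y by (simp add: dist_norm norm_minus_commute)
      then have "L * norm (y - x) \<le> L * r" using L by (rule mult_left_mono)
      with near[OF yR] show ?thesis by simp
    qed
    \<comment> \<open>The summand \<open>1\<close> in \<open>E\<close> leaves a margin \<open>r\<close>, which makes the inclusion strict.\<close>
    have in_ball: "z \<in> ball x R" if "norm (z - f y) \<le> a * L * r * (1 - \<tau> ^ k) / (1 - \<tau>)" for z k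
    proof -
      have "a * L * r * (1 - \<tau> ^ k) / (1 - \<tau>) \<le> a * L * r * 1 / (1 - \<tau>)"
        using a L r \<tau> by (intro divide_right_mono mult_left_mono) auto
      then have "norm (z - x) \<le> L * r + a * L * r / (1 - \<tau>)"
        using that f1 norm_triangle_ineq[of "z - f y" "f y - x"] by simp
      also have "\<dots> = R - r" unfolding r(3)[symmetric] by (simp add: E_def algebra_simps)
      finally show ?thesis using r by (simp add: dist_norm norm_minus_commute)
    qed
    show ?thesis
    proof (induction k)
      case 0
      have "f y \<in> ball x R" by (rule in_ball[where k = 0]) simp
      then show ?case using f_in[OF yR] f1 d_le[of "f y"] by simp
    next
      case (Suc k)
      let ?z = "(f ^^ Suc k) y"
      have z: "?z \<in> M" "?z \<in> ball x R" "d ?z \<le> \<tau> ^ k * (L * r)"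
          "norm (?z - f y) \<le> a * L * r * (1 - \<tau> ^ k) / (1 - \<tau>)" using Suc.IH by auto
      have d: "d (f ?z) \<le> \<tau> * (\<tau> ^ k * (L * r))"
        using order_trans[OF contr[OF z(1,2)] mult_left_mono[OF z(3)]] \<tau> by simp
      have "norm (f ?z - ?z) \<le> a * (\<tau> ^ k * (L * r))"
        by (rule order_trans[OF move[OF z(1,2)] mult_left_mono[OF z(3) a]])
      then have "norm (f ?z - f y) \<le> a * (\<tau> ^ k * (L * r)) + a * L * r * (1 - \<tau> ^ k) / (1 - \<tau>)"
        using z(4) norm_triangle_ineq[of "f ?z - ?z" "?z - f y"] by simp
      also have "\<dots> = a * L * r * (1 - \<tau> ^ Suc k) / (1 - \<tau>)"
        using \<tau> by (simp add: field_simps)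
      finally have n: "norm (f ?z - f y) \<le> a * L * r * (1 - \<tau> ^ Suc k) / (1 - \<tau>)" .
      show ?case using f_in[OF z(2)] in_ball[OF n] d n by (simp add: algebra_simps)
    qed
  qed
  show ?thesis
  proof (rule that[OF r(1)])
    show "C \<ge> 0" using C L r by (meson dual_order.trans mult_nonneg_nonneg less_imp_le)
    fix y k assume y: "y \<in> ball x r"
    then have yR: "y \<in> ball x R" using r by auto
    show "(f ^^ k) y \<in> ball x R" using orbit[OF y] yR by (cases k) auto
    show "norm ((f ^^ Suc k) y - (f ^^ k) y) \<le> C * \<tau> ^ k"
    proof (cases k)
      case 0
      have "norm (f y - y) \<le> norm (f y - x) + norm (y - x)"
        using norm_triangle_ineq4[of "f y - x" "y - x"] by simp
      also have "\<dots> \<le> L * norm (y - x) + norm (y - x)" using near[OF yR] by simp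
      also have "\<dots> = (L + 1) * norm (y - x)" by (simp add: algebra_simps)
      also have "\<dots> \<le> (L + 1) * r"
        using y L by (intro mult_left_mono) (auto simp: dist_norm norm_minus_commute)
      also have "\<dots> \<le> C" using a L r \<tau> by (simp add: C_def)
      finally show ?thesis using 0 by simp
    next
      case (Suc j)
      let ?z = "(f ^^ Suc j) y"
      have "norm (f ?z - ?z) \<le> a * (\<tau> ^ j * (L * r))"
        using move[of ?z] orbit[OF y, of j] mult_left_mono[OF _ a, of "d ?z" "\<tau> ^ j * (L * r)"] by simp
      also have "\<dots> = (a * L * r / \<tau>) * \<tau> ^ Suc j" using \<tau> by simp
      also have "\<dots> \<le> C * \<tau> ^ Suc j"
        using L r \<tau> by (intro mult_right_mono) (auto simp: C_def)
      finally show ?thesis using Suc by simp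
    qed
    have "d ((f ^^ Suc k) y) \<le> (L * r) * \<tau> ^ k" using orbit[OF y, of k] by (simp add: mult.commute)
    also have "\<dots> \<le> C * \<tau> ^ k" using C \<tau> by (intro mult_right_mono) auto
    finally show "d ((f ^^ Suc k) y) \<le> C * \<tau> ^ k" .
  qed
qed

section \<open>Alternating maps near a clean intersection\<close>

text \<open>
  With this the cases of the alternating framework merge: both maps are always first-order
  consistent.
\<close>

lemma closest_point_first_order_consistent:
  assumes "open V" "\<And>y. y \<in> V \<Longrightarrow> \<phi> y = closest_point D y"
  shows "first_order_consistent D \<phi> V"
  unfolding first_order_consistent_def
proof (intro ballI landau_o.smallI)
  fix x and c :: real assume "x \<in> V \<inter> D" "c > 0"
  then have "\<forall>\<^sub>F y in at x. y \<in> V" using assms(1) by (simp add: eventually_at_in_open')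
  then show "\<forall>\<^sub>F y in at x. norm (norm (\<phi> y - closest_point D y)) \<le> c * norm (infdist y D)"
    using \<open>c > 0\<close> assms(2) by (auto elim!: eventually_mono)
qed

text \<open>
  The local form of the result at a point \<open>x\<close> of the intersection, in a neighbourhood \<open>V\<close> where all
  hypotheses hold. The estimate of the steps of an orbit compares \<open>f y\<close> with \<open>f p = p\<close> for the point \<open>p\<close>
  of \<open>M\<close> closest to \<open>y\<close>. The limit of an orbit has distance \<open>0\<close> to \<open>M\<close> and coincides with its projection,
  hence it lies in \<open>M\<close> although \<open>M\<close> may fail to be closed.
\<close>

lemma alternating_limit_locally_C1:
  fixes M1 M2 V :: "'a::euclidean_space set" and \<phi>1 \<phi>2 :: "'a \<Rightarrow> 'a" and f' :: "'a \<Rightarrow> 'a \<Rightarrow>\<^sub>L 'a"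
  defines "M \<equiv> M1 \<inter> M2" and "f \<equiv> \<phi>1 \<circ> \<phi>2"
  assumes V: "open V" "x \<in> M" "ball x R \<subseteq> V" and R: "R > 0"
    and wd: "\<And>D y. D \<in> {M1, M2, M} \<Longrightarrow> y \<in> V \<Longrightarrow> proj_well_defined D y"
    and proj_C1: "\<And>D. D \<in> {M1, M2, M} \<Longrightarrow> Ck_on 1 V (closest_point D)"
    and \<phi>_C1: "Ck_on 1 V \<phi>1" "Ck_on 1 V \<phi>2" and \<phi>1_in: "\<phi>1 ` V \<subseteq> M1"
    and con: "first_order_consistent M1 \<phi>1 V" "first_order_consistent M2 \<phi>2 V"
    and clean: "\<And>z. z \<in> M \<inter> V \<Longrightarrow> tangent_space M z = tangent_space M1 z \<inter> tangent_space M2 z"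
    and angle: "c < 1" "\<And>z. z \<in> M \<inter> V \<Longrightarrow>
      onorm (\<lambda>u. closest_point (tangent_space M1 z) (closest_point (tangent_space M2 z) u)
                 - closest_point (tangent_space M z) u) \<le> c"
    and \<kappa>: "\<kappa> \<ge> 0" "\<And>y. y \<in> M1 \<inter> V \<Longrightarrow> infdist y M \<le> \<kappa> * infdist y M2"
    and \<tau>: "0 < \<tau>" "\<tau> < 1" "\<And>y. y \<in> M1 \<inter> V \<Longrightarrow> infdist (f y) M2 \<le> \<tau> * infdist y M2"
    and der: "\<And>y. y \<in> ball x R \<Longrightarrow> (f has_derivative blinfun_apply (f' y)) (at y)"
    and lip: "L-lipschitz_on (ball x R) f'"
  obtains r G where "r > 0"
    "\<And>y k. y \<in> ball x r \<Longrightarrow> (f ^^ k) y \<in> V \<and> \<phi>2 ((f ^^ k) y) \<in> V"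
    "\<And>y. y \<in> ball x r \<Longrightarrow> (\<lambda>k. (f ^^ k) y) \<longlonglongrightarrow> lim (\<lambda>k. (f ^^ k) y)"
    "\<And>y. y \<in> ball x r \<Longrightarrow> lim (\<lambda>k. (f ^^ k) y) \<in> M"
    "\<And>y. y \<in> ball x r \<Longrightarrow> ((\<lambda>y. lim (\<lambda>k. (f ^^ k) y)) has_derivative blinfun_apply (G y)) (at y)"
    "continuous_on (ball x r) G"
    "\<And>z. z \<in> M \<Longrightarrow> z \<in> ball x r \<Longrightarrow> lim (\<lambda>k. (f ^^ k) z) = z"
    "\<And>z \<eta>. z \<in> M \<Longrightarrow> z \<in> ball x r \<Longrightarrow> \<eta> \<in> tangent_space M z \<Longrightarrow> G z \<eta> = \<eta>"
proof -
  define P where "P z = Blinfun (closest_point (tangent_space M z))" for z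
  have at_M: "\<phi>2 z = z \<and> f z = z \<and> (\<exists>Q1 Q2 Q. orth_projection Q1 (tangent_space M1 z) \<and>
      orth_projection Q2 (tangent_space M2 z) \<and> orth_projection Q (tangent_space M z) \<and>
      (f has_derivative (\<lambda>v. Q1 (Q2 v))) (at z))" if z: "z \<in> M" "z \<in> V" for z
  proof -
    have z12: "z \<in> M1" "z \<in> M2" using z by (auto simp: M_def)
    obtain Q1 where Q1: "(closest_point M1 has_derivative Q1) (at z)" "orth_projection Q1 (tangent_space M1 z)"
      by (rule has_derivative_closest_point[OF V(1) z(2) z12(1) wd proj_C1]) auto
    obtain Q2 where Q2: "(closest_point M2 has_derivative Q2) (at z)" "orth_projection Q2 (tangent_space M2 z)"
      by (rule has_derivative_closest_point[OF V(1) z(2) z12(2) wd proj_C1]) auto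
    obtain Q where Q: "orth_projection Q (tangent_space M z)"
      by (rule has_derivative_closest_point[OF V(1) z(2) z(1) wd proj_C1]) auto
    have cont: "isCont \<phi>1 z" "isCont \<phi>2 z"
      using \<phi>_C1 z(2) by (auto intro: has_derivative_continuous[OF has_derivative_frechet_derivative])
    note d1 = first_order_consistent_has_derivative[OF con(1) z(2) z12(1) cont(1) Q1(1)]
    note d2 = first_order_consistent_has_derivative[OF con(2) z(2) z12(2) cont(2) Q2(1)]
    have "(f has_derivative (\<lambda>v. Q1 (Q2 v))) (at z)"
      using has_derivative_compose[OF d2(2), of \<phi>1 Q1] d1(2) d2(1) by (simp add: f_def o_def)
    with Q1(2) Q2(2) Q d1(1) d2(1) show ?thesis by (auto simp: f_def)
  qed
  have "x \<in> V" using V(3) R by auto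
  with at_M[OF V(2)] have x: "\<phi>2 x = x" "f x = x" by auto
  have "open {y \<in> V. \<phi>2 y \<in> V}"
  proof -
    have "continuous_on V \<phi>2"
      using has_derivative_frechet_derivative[OF \<phi>_C1(2)]
      by (auto intro!: continuous_at_imp_continuous_on has_derivative_continuous)
    from continuous_open_preimage[OF this V(1) V(1)] show ?thesis
      by (simp add: vimage_def Int_def)
  qed
  moreover have "x \<in> {y \<in> V. \<phi>2 y \<in> V}" using x \<open>x \<in> V\<close> by simp
  ultimately obtain R1 where R1: "R1 > 0" "ball x R1 \<subseteq> {y \<in> V. \<phi>2 y \<in> V}"
    using open_contains_ball by blast
  define R0 where "R0 = min R R1"
  let ?B = "ball x R0"
  have R0: "R0 > 0" "?B \<subseteq> ball x R" "?B \<subseteq> V" "\<And>y. y \<in> ?B \<Longrightarrow> \<phi>2 y \<in> V"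
    using R R1 V(3) by (auto simp: R0_def)
  have der0: "(f has_derivative blinfun_apply (f' y)) (at y)" if "y \<in> ?B" for y
    using der R0(2) that by blast
  have lip0: "L-lipschitz_on ?B f'" using lip R0(2) by (rule lipschitz_on_subset)
  have L: "L \<ge> 0" by (rule lipschitz_on_nonneg[OF lip])
  define Lf where "Lf = norm (f' x) + L * R0"
  have Lf: "Lf-lipschitz_on ?B f"
  proof (rule bounded_derivative_imp_lipschitz)
    fix y assume y: "y \<in> ?B"
    show "(f has_derivative blinfun_apply (f' y)) (at y within ?B)"
      using der0[OF y] by (rule has_derivative_at_withinI)
    have "norm (f' y - f' x) \<le> L * dist y x"
      using lipschitz_onD[OF lip0 y, of x] R0(1) by (simp add: dist_norm)
    also have "\<dots> \<le> L * R0" using y L by (intro mult_left_mono) (auto simp: dist_commute)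
    finally have "norm (f' y) \<le> Lf"
      using norm_triangle_ineq[of "f' y - f' x" "f' x"] by (simp add: Lf_def)
    then show "onorm (blinfun_apply (f' y)) \<le> Lf" by (simp add: norm_blinfun.rep_eq)
  qed (use L R0(1) in \<open>auto simp: Lf_def\<close>)
  have Lf0: "Lf \<ge> 0" by (rule lipschitz_on_nonneg[OF Lf])
  \<comment> \<open>Half of the radius, because the projection onto \<open>M\<close> of a point of \<open>ball x R'\<close> may be twice as far
    from \<open>x\<close>, and because the limit of an orbit lies in the closed ball only.\<close>
  define R' where "R' = R0 / 2"
  have R': "R' > 0" "ball x R' \<subseteq> ?B" "cball x R' \<subseteq> ?B" using R0(1) by (auto simp: R'_def)
  have x_in: "x \<in> ?B" using R0(1) by simp
  obtain r C where r: "r > 0" and C: "C \<ge> 0"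
    and orbit: "\<And>y k. y \<in> ball x r \<Longrightarrow> (f ^^ k) y \<in> ball x R'"
    and step: "\<And>y k. y \<in> ball x r \<Longrightarrow> norm ((f ^^ Suc k) y - (f ^^ k) y) \<le> C * \<tau> ^ k"
    and decay: "\<And>y k. y \<in> ball x r \<Longrightarrow> infdist ((f ^^ Suc k) y) M2 \<le> C * \<tau> ^ k"
  proof (rule contracting_orbits_stay[of R' \<tau> Lf "(Lf + 1) * \<kappa>" x f M1 "\<lambda>y. infdist y M2"])
    fix y assume yR': "y \<in> ball x R'"
    then have y: "y \<in> ?B" using R'(2) by blast
    show "f y \<in> M1" using R0(4)[OF y] \<phi>1_in by (auto simp: f_def)
    show "norm (f y - x) \<le> Lf * norm (y - x)"
      using lipschitz_onD[OF Lf y x_in] x by (simp add: dist_norm)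
    assume yM1: "y \<in> M1"
    then have yV: "y \<in> M1 \<inter> V" using y R0(3) by auto
    then show "infdist (f y) M2 \<le> \<tau> * infdist y M2" by (rule \<tau>(3))
    let ?p = "closest_point M y"
    have p: "?p \<in> M" "infdist y M = norm (y - ?p)"
      using proj_well_definedD[OF wd[of M y]] yV by auto
    have "dist x ?p \<le> dist x y + norm (y - ?p)" using dist_triangle[of x ?p y] by (simp add: dist_norm)
    also have "\<dots> \<le> dist x y + dist x y"
      using infdist_le[OF V(2), of y] p(2) by (simp add: dist_commute)
    also have "\<dots> < R0" using yR' by (simp add: R'_def)
    finally have pB: "?p \<in> ?B" by simp
    then have "f ?p = ?p" using at_M[OF p(1)] R0(3) by auto
    then have "norm (f y - y) \<le> norm (f y - f ?p) + norm (y - ?p)"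
      using norm_triangle_ineq4[of "f y - f ?p" "y - ?p"] by simp
    also have "\<dots> \<le> (Lf + 1) * infdist y M"
      using lipschitz_onD[OF Lf y pB] p(2) by (simp add: dist_norm algebra_simps)
    also have "\<dots> \<le> (Lf + 1) * (\<kappa> * infdist y M2)"
      using \<kappa>(2)[OF yV] Lf0 by (intro mult_left_mono) auto
    finally show "norm (f y - y) \<le> (Lf + 1) * \<kappa> * infdist y M2" by (simp add: mult.assoc)
  next
    show "infdist y M2 \<le> norm (y - x)" for y
      using infdist_le[of x M2 y] V(2) by (simp add: M_def dist_norm)
  qed (use R'(1) \<tau> Lf0 \<kappa>(1) in auto)
  have orbit0: "(f ^^ k) y \<in> ?B" if "y \<in> ball x r" for y k using orbit[OF that] R'(2) by blast
  have conv: "(\<lambda>k. (f ^^ k) y) \<longlonglongrightarrow> lim (\<lambda>k. (f ^^ k) y)" if "y \<in> ball x r" for y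
    by (rule geometric_steps_limit(1)[OF \<tau>(1,2) step[OF that]])
  have lim_in: "lim (\<lambda>k. (f ^^ k) y) \<in> M \<inter> ?B" if y: "y \<in> ball x r" for y
  proof -
    let ?l = "lim (\<lambda>k. (f ^^ k) y)"
    have "?l \<in> cball x R'"
      by (rule Lim_in_closed_set[OF closed_cball _ _ conv[OF y]])
        (use orbit[OF y] in \<open>auto intro!: always_eventually simp: less_imp_le\<close>)
    then have lB: "?l \<in> ?B" using R'(3) by blast
    have bound: "infdist ((f ^^ Suc k) y) M \<le> \<kappa> * (C * \<tau> ^ k)" for k
    proof -
      have "(f ^^ Suc k) y \<in> M1"
        using R0(4)[OF orbit0[OF y, of k]] \<phi>1_in by (auto simp: f_def)
      then have "(f ^^ Suc k) y \<in> M1 \<inter> V" using orbit0[OF y, of "Suc k"] R0(3) by auto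
      from \<kappa>(2)[OF this] show ?thesis
        using mult_left_mono[OF decay[OF y, of k] \<kappa>(1)] by simp
    qed
    have "(\<lambda>k. \<kappa> * (C * \<tau> ^ k)) \<longlonglongrightarrow> \<kappa> * (C * 0)"
      using \<tau> by (intro tendsto_intros LIMSEQ_power_zero) auto
    then have lim0: "(\<lambda>k. \<kappa> * (C * \<tau> ^ k)) \<longlonglongrightarrow> 0" by simp
    have limd: "(\<lambda>k. infdist ((f ^^ Suc k) y) M) \<longlonglongrightarrow> infdist ?l M"
      using LIMSEQ_Suc[OF conv[OF y]] by (rule tendsto_infdist)
    have "infdist ?l M \<le> 0"
      by (rule LIMSEQ_le[OF limd lim0]) (use bound in blast)
    then have "infdist ?l M = 0" using infdist_nonneg[of ?l M] by simp
    moreover have "proj_well_defined M ?l" using lB R0(3) by (intro wd) auto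
    note proj = proj_well_definedD(1,3)[OF this]
    ultimately have "norm (?l - closest_point M ?l) = 0" by (simp only: proj(2))
    then have "?l = closest_point M ?l" by (simp only: norm_eq_zero right_minus_eq)
    from ssubst[OF this, of "\<lambda>z. z \<in> M", OF proj(1)] have "?l \<in> M" .
    with lB show ?thesis by blast
  qed
  have neutral: "norm (f' z) \<le> 1 \<and> norm (P z) \<le> 1 \<and> norm (f' z - P z) \<le> c \<and>
      (\<forall>v. f' z (P z v) = P z v \<and> P z (f' z v) = P z v \<and> P z (P z v) = P z v) \<and>
      (\<forall>v\<in>tangent_space M z. P z v = v)" if z: "z \<in> M \<inter> ?B" for z
  proof -
    have zV: "z \<in> M \<inter> V" using z R0(3) by auto
    obtain Q1 Q2 Q where Q1: "orth_projection Q1 (tangent_space M1 z)"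
      and Q2: "orth_projection Q2 (tangent_space M2 z)" and Q: "orth_projection Q (tangent_space M z)"
      and d: "(f has_derivative (\<lambda>v. Q1 (Q2 v))) (at z)" using at_M[of z] zV by auto
    have f': "blinfun_apply (f' z) = (\<lambda>v. Q1 (Q2 v))"
      using has_derivative_unique[OF der0 d] z by auto
    have "closest_point (tangent_space M z) = Q"
      by (rule ext) (rule closest_point_orth_projection[OF Q])
    then have P: "blinfun_apply (P z) = Q"
      by (simp add: P_def bounded_linear_Blinfun_apply orth_projectionD(1)[OF Q])
    have sub: "tangent_space M z \<subseteq> tangent_space M1 z" "tangent_space M z \<subseteq> tangent_space M2 z"
      using clean[OF zV] by auto
    have "norm (f' z) \<le> 1"
      by (rule norm_blinfun_bound)
        (auto simp: f' intro: order_trans[OF norm_orth_projection_le[OF Q1] norm_orth_projection_le[OF Q2]])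
    moreover have "norm (P z) \<le> 1"
      by (rule norm_blinfun_bound) (auto simp: P norm_orth_projection_le[OF Q])
    moreover have "norm (f' z - P z) \<le> c"
    proof -
      have "blinfun_apply (f' z - P z) = (\<lambda>u. closest_point (tangent_space M1 z)
          (closest_point (tangent_space M2 z) u) - closest_point (tangent_space M z) u)"
        by (rule ext) (simp add: blinfun.diff_left f' P closest_point_orth_projection[OF Q1]
          closest_point_orth_projection[OF Q2] closest_point_orth_projection[OF Q])
      with angle(2)[OF zV] show ?thesis by (simp add: norm_blinfun.rep_eq)
    qed
    ultimately show ?thesis
      using orth_projection_absorb[OF Q Q1 sub(1)] orth_projection_absorb[OF Q Q2 sub(2)]
        orth_projectionD(3,4)[OF Q] by (simp add: f' P)
  qed
  obtain G where G: "\<And>y. y \<in> ball x r \<Longrightarrow>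
      ((\<lambda>y. lim (\<lambda>k. (f ^^ k) y)) has_derivative blinfun_apply (G y)) (at y)"
    "continuous_on (ball x r) G"
    "\<And>z. z \<in> ball x r \<Longrightarrow> z \<in> M \<inter> ?B \<Longrightarrow> f z = z \<Longrightarrow> G z = P z"
    by (rule iteration_limit_C1[of "ball x r" f ?B f' L \<tau> C "M \<inter> ?B" P c])
      (use orbit0 der0 lip0 \<tau> C step lim_in neutral angle(1) in auto)
  have r_sub: "ball x r \<subseteq> ?B" using orbit0[of _ 0] by auto
  have fix_M: "f z = z" if "z \<in> M" "z \<in> ball x r" for z
    using at_M[of z] that r_sub R0(3) by blast
  show ?thesis
  proof (rule that[OF r _ conv _ G(1,2)])
    show "(f ^^ k) y \<in> V \<and> \<phi>2 ((f ^^ k) y) \<in> V" if "y \<in> ball x r" for y k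
      using orbit0[OF that, of k] R0(3,4) by blast
    show "lim (\<lambda>k. (f ^^ k) y) \<in> M" if "y \<in> ball x r" for y using lim_in[OF that] by blast
    show "lim (\<lambda>k. (f ^^ k) z) = z" if "z \<in> M" "z \<in> ball x r" for z
    proof -
      have "(f ^^ k) z = z" for k using fix_M[OF that] by (induction k) auto
      then show ?thesis by (simp add: limI)
    qed
    show "G z \<eta> = \<eta>" if "z \<in> M" "z \<in> ball x r" "\<eta> \<in> tangent_space M z" for z \<eta>
      using G(3)[OF that(2) _ fix_M[OF that(1,2)]] neutral[of z] that r_sub by auto
  qed
qed

section \<open>The retraction\<close>

lemma Ck_on_mono: "Ck_on k U f \<Longrightarrow> V \<subseteq> U \<Longrightarrow> Ck_on k V f"
  unfolding Ck_on_def by (blast intro: continuous_on_subset)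

lemma Ck_on_1_compose_add:
  assumes "Ck_on 1 B f"
  shows "Ck_on 1 {s. fst s + snd s \<in> B} (\<lambda>s. f (fst s + snd s))"
proof (rule Ck_on_1I[where f' = "\<lambda>s h. frechet_derivative f (at (fst s + snd s)) (fst h + snd h)"])
  fix s :: "'a \<times> 'a" assume "s \<in> {s. fst s + snd s \<in> B}"
  then have "(f has_derivative frechet_derivative f (at (fst s + snd s))) (at (fst s + snd s))"
    using has_derivative_frechet_derivative[OF assms] by simp
  moreover have "((\<lambda>s. fst s + snd s) has_derivative (\<lambda>h. fst h + snd h)) (at s)"
    by (auto intro!: derivative_eq_intros)
  ultimately show "((\<lambda>s. f (fst s + snd s)) has_derivative
      (\<lambda>h. frechet_derivative f (at (fst s + snd s)) (fst h + snd h))) (at s)"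
    using has_derivative_compose by blast
next
  fix h :: "'a \<times> 'a"
  have "continuous_on B (\<lambda>y. frechet_derivative f (at y) (fst h + snd h))"
    using assms unfolding Ck_on_1_iff by blast
  then show "continuous_on {s. fst s + snd s \<in> B}
      (\<lambda>s. frechet_derivative f (at (fst s + snd s)) (fst h + snd h))"
    by (rule continuous_on_compose2) (auto intro!: continuous_intros)
qed

text \<open>
  A derivative within a set matters only through its values on increments inside the set. For an
  increment in a tangent space the derivative of the limit map can be replaced by the identity.
\<close>

lemma has_derivative_within_eq_on:
  assumes "(f has_derivative D) (at a within S)" "bounded_linear D'"
    and "\<And>y. y \<in> S \<Longrightarrow> D (y - a) = D' (y - a)"
  shows "(f has_derivative D') (at a within S)"
proof -
  have "\<forall>\<^sub>F y in at a within S. norm (f y - f a - D (y - a)) / norm (y - a)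
      = norm (f y - f a - D' (y - a)) / norm (y - a)"
    using assms(3) by (simp add: eventually_at_filter)
  from tendsto_cong[OF this] show ?thesis
    using assms(1,2) unfolding has_derivative_iff_norm by blast
qed

text \<open>
  It remains to find a neighbourhood on which all hypotheses hold at once. The limit of an orbit that
  starts near \<open>x\<close> need not lie in \<open>K\<close> when \<open>x\<close> is on the boundary of \<open>\<Omega>\<close>; this is why the angle bound
  and the consistency of the maps are used on a neighbourhood of \<open>x\<close> in the intersection and not just
  on \<open>K\<close>. The Lipschitz bound for the derivative is given for \<open>p = 2\<close> and follows from class \<open>C\<^sup>2\<close>
  for \<open>p \<ge> 3\<close>.
\<close>

lemma alternating_limit_near_base_point:
  fixes M1 M2 U\<^sub>M U \<Omega> K :: "'a::euclidean_space set" and \<phi>1 \<phi>2 :: "'a \<Rightarrow> 'a"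
  assumes p: "p \<ge> 2"
    and sets: "local_sets p M1 M2 \<phi>1 \<phi>2 xbar U\<^sub>M U \<Omega> K"
    and frame: "alternating_framework_at p M1 M2 \<phi>1 \<phi>2 U x"
    and radius: "admissible_radius M1 M2 \<phi>1 \<phi>2 U \<Omega> K \<delta>"
    and decomp: "decomposition_property p M1 M2 \<phi>1 \<phi>2 U K \<delta>"
    and x: "x \<in> K"
  defines "\<Psi> \<equiv> \<lambda>y. lim (alt_iterate \<phi>1 \<phi>2 y)"
  obtains r where "r > 0" "Ck_on 1 (ball x r) \<Psi>"
    "\<And>y. y \<in> ball x r \<Longrightarrow> iterates_well_defined \<phi>1 \<phi>2 U y"
    "\<And>y. y \<in> ball x r \<Longrightarrow> alt_iterate \<phi>1 \<phi>2 y \<longlonglongrightarrow> \<Psi> y"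
    "\<And>y. y \<in> ball x r \<Longrightarrow> \<Psi> y \<in> M1 \<inter> M2" "\<Psi> x = x"
    "\<And>\<eta>. \<eta> \<in> tangent_space (M1 \<inter> M2) x \<Longrightarrow> frechet_derivative \<Psi> (at x) \<eta> = \<eta>"
proof -
  let ?M = "M1 \<inter> M2"
  let ?f = "\<phi>1 \<circ> \<phi>2"
  note sets' = sets[unfolded local_sets_def Let_def]
  from sets' have UM: "openin (top_of_set ?M) U\<^sub>M"
    and clean: "\<And>z. z \<in> U\<^sub>M \<Longrightarrow> tangent_space ?M z = tangent_space M1 z \<inter> tangent_space M2 z"
    and wd: "\<And>D y. D \<in> {M1, M2, ?M} \<Longrightarrow> y \<in> U \<Longrightarrow> proj_well_defined D y"
    and proj: "\<And>D. D \<in> {M1, M2, ?M} \<Longrightarrow> Ck1_on (p - 1) U (closest_point D)"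
    and \<phi>: "Ck1_on (p - 1) U \<phi>1" "Ck1_on (p - 1) U \<phi>2"
    and K: "K = top_of_set ?M closure_of \<Omega>" "K \<subseteq> U\<^sub>M \<inter> U"
    by blast+
  from sets' obtain c where c: "c < 1" "\<And>z. z \<in> U\<^sub>M \<Longrightarrow>
      onorm (\<lambda>u. closest_point (tangent_space M1 z) (closest_point (tangent_space M2 z) u)
                 - closest_point (tangent_space ?M z) u) \<le> c" by blast
  from sets' obtain \<kappa> where \<kappa>: "\<kappa> > 0" "\<And>y. y \<in> M1 \<inter> U \<Longrightarrow> infdist y ?M \<le> \<kappa> * infdist y M2" by blast
  from radius obtain \<tau> where \<tau>: "0 < \<tau>" "\<tau> < 1"
      "\<And>y. y \<in> M1 \<inter> tube \<delta> K \<Longrightarrow> infdist (?f y) M2 \<le> \<tau> * infdist y M2"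
    and \<delta>: "\<delta> > 0"
    unfolding admissible_radius_def by blast
  have Ck1D: "Ck_on 1 V g" if "Ck1_on (p - 1) U g" "V \<subseteq> U" for g :: "'a \<Rightarrow> 'a" and V
    using that p Ck_on_imp_Ck_on_1[of "p - 1" U g] Ck_on_mono unfolding Ck1_on_def by force
  have xM: "x \<in> ?M" using x K(1) closure_of_subset_topspace[of "top_of_set ?M" \<Omega>] by auto
  obtain W where W: "open W" "U\<^sub>M = ?M \<inter> W" using UM by (auto simp: openin_open)
  obtain V0 where V0: "open V0" "x \<in> V0" "V0 \<subseteq> U" "\<phi>1 ` V0 \<subseteq> M1"
    and con: "first_order_consistent M1 \<phi>1 V0" "first_order_consistent M2 \<phi>2 V0"
  proof -
    from frame obtain V0 where "open V0" "x \<in> V0" "V0 \<subseteq> U" "\<phi>1 ` V0 \<subseteq> M1" and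
      "(\<forall>y\<in>V0. \<phi>1 y = closest_point M1 y) \<and> first_order_consistent M2 \<phi>2 V0 \<or>
       (\<forall>y\<in>V0. \<phi>2 y = closest_point M2 y) \<and> first_order_consistent M1 \<phi>1 V0 \<or>
       first_order_consistent M1 \<phi>1 V0 \<and> first_order_consistent M2 \<phi>2 V0"
      unfolding alternating_framework_at_def by blast
    then show thesis using that[of V0] closest_point_first_order_consistent[of V0] by blast
  qed
  define V where "V = V0 \<inter> W \<inter> tube \<delta> K"
  have "open (tube \<delta> K)"
    unfolding tube_def by (intro open_Collect_less continuous_intros)
  then have V: "open V" "V \<subseteq> U" "V \<subseteq> V0" "V \<subseteq> tube \<delta> K" "?M \<inter> V \<subseteq> U\<^sub>M"
    using V0 W by (auto simp: V_def)
  have "x \<in> V" using x K(2) W V0(2) \<delta> by (auto simp: V_def tube_def)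
  then obtain R where R: "R > 0" "cball x R \<subseteq> V" using V(1) open_contains_cball by blast
  then have ballR: "ball x R \<subseteq> V" "cball x R \<subseteq> tube \<delta> K" using ball_subset_cball V(4) by auto
  obtain L and f' :: "'a \<Rightarrow> 'a \<Rightarrow>\<^sub>L 'a" where
    der: "\<And>y. y \<in> ball x R \<Longrightarrow> (?f has_derivative blinfun_apply (f' y)) (at y)"
    and lip: "L-lipschitz_on (ball x R) f'"
  proof -
    have "Ck_on 1 (tube \<delta> K) ?f \<and> (\<forall>b\<in>Basis. \<exists>L. L-lipschitz_on (ball x R) (iter_deriv [b] ?f))"
    proof (cases "p = 2")
      case True
      with decomp obtain L where C1: "Ck_on 1 (tube \<delta> K) ?f" and
        L: "\<And>vs. length vs = 1 \<Longrightarrow> \<forall>v\<in>set vs. norm v \<le> 1 \<Longrightarrow> L-lipschitz_on (tube \<delta> K) (iter_deriv vs ?f)"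
        unfolding decomposition_property_def lipschitz_deriv_on_def by blast
      have "L-lipschitz_on (ball x R) (iter_deriv [b] ?f)" if "b \<in> Basis" for b
      proof (rule lipschitz_on_subset[OF L])
        show "ball x R \<subseteq> tube \<delta> K" using ballR V(4) by blast
      qed (use that in auto)
      with C1 show ?thesis by blast
    next
      case False
      with decomp p have C2: "Ck_on 2 (tube \<delta> K) ?f"
        unfolding decomposition_property_def Ck1_on_def by auto
      then have "Ck_on 1 (tube \<delta> K) ?f" by (rule Ck_on_imp_Ck_on_1) simp
      with Ck_on_2_locally_lipschitz_directional[OF C2 ballR(2)] show ?thesis by blast
    qed
    then have "\<exists>L. \<exists>f' :: 'a \<Rightarrow> 'a \<Rightarrow>\<^sub>L 'a.
        (\<forall>y\<in>ball x R. (?f has_derivative blinfun_apply (f' y)) (at y)) \<and> L-lipschitz_on (ball x R) f'"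
      using ballR V(4) by (intro locally_lipschitz_derivative[of "tube \<delta> K"]) auto
    then show thesis using that by blast
  qed
  have iter: "alt_iterate \<phi>1 \<phi>2 y = (\<lambda>k. (?f ^^ k) y)" for y
    by (rule ext) (simp add: alt_iterate_def)
  have \<Psi>: "\<Psi> = (\<lambda>y. lim (\<lambda>k. (?f ^^ k) y))" by (simp add: \<Psi>_def iter)
  have con': "first_order_consistent M1 \<phi>1 V" "first_order_consistent M2 \<phi>2 V"
    using con V(3) unfolding first_order_consistent_def by blast+
  obtain r G where r: "r > 0"
    and wdf: "\<And>y k. y \<in> ball x r \<Longrightarrow> (?f ^^ k) y \<in> V \<and> \<phi>2 ((?f ^^ k) y) \<in> V"
    and conv: "\<And>y. y \<in> ball x r \<Longrightarrow> (\<lambda>k. (?f ^^ k) y) \<longlonglongrightarrow> \<Psi> y"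
    and lim_in: "\<And>y. y \<in> ball x r \<Longrightarrow> \<Psi> y \<in> ?M"
    and G: "\<And>y. y \<in> ball x r \<Longrightarrow> (\<Psi> has_derivative blinfun_apply (G y)) (at y)"
      "continuous_on (ball x r) G"
    and fixed: "\<And>z. z \<in> ?M \<Longrightarrow> z \<in> ball x r \<Longrightarrow> \<Psi> z = z"
    and tangent: "\<And>z \<eta>. z \<in> ?M \<Longrightarrow> z \<in> ball x r \<Longrightarrow> \<eta> \<in> tangent_space ?M z \<Longrightarrow> G z \<eta> = \<eta>"
    unfolding \<Psi>
  proof (rule alternating_limit_locally_C1[OF V(1) xM ballR(1) R(1), of \<phi>1 \<phi>2 c \<kappa> \<tau> f' L])
    show "proj_well_defined D y" if "D \<in> {M1, M2, ?M}" "y \<in> V" for D y using wd that V(2) by blast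
    show "Ck_on 1 V (closest_point D)" if "D \<in> {M1, M2, ?M}" for D using Ck1D proj[OF that] V(2) by blast
    show "Ck_on 1 V \<phi>1" "Ck_on 1 V \<phi>2" using Ck1D \<phi> V(2) by blast+
    show "\<phi>1 ` V \<subseteq> M1" using V0(4) V(3) by blast
    show "tangent_space ?M z = tangent_space M1 z \<inter> tangent_space M2 z" if "z \<in> ?M \<inter> V" for z
      using clean that V(5) by blast
    show "onorm (\<lambda>u. closest_point (tangent_space M1 z) (closest_point (tangent_space M2 z) u)
                 - closest_point (tangent_space ?M z) u) \<le> c" if "z \<in> ?M \<inter> V" for z
      using c(2) that V(5) by blast
    show "infdist y ?M \<le> \<kappa> * infdist y M2" if "y \<in> M1 \<inter> V" for y using \<kappa>(2) that V(2) by blast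
    show "infdist (?f y) M2 \<le> \<tau> * infdist y M2" if "y \<in> M1 \<inter> V" for y using \<tau>(3) that V(4) by blast
  qed (use con' c(1) \<kappa>(1) \<tau>(1,2) der lip in \<open>auto simp: \<Psi>\<close>)
  have x_in: "x \<in> ball x r" using r by simp
  show thesis
  proof (rule that[OF r])
    have "continuous_on (ball x r) (\<lambda>y. G y v)" for v
      using G(2) by (intro continuous_intros)
    then show "Ck_on 1 (ball x r) \<Psi>" using Ck_on_1I[OF G(1)] by blast
    show "iterates_well_defined \<phi>1 \<phi>2 U y" if "y \<in> ball x r" for y
      unfolding iterates_well_defined_def alt_defined_def iter using wdf[OF that] V(2) by blast
    show "alt_iterate \<phi>1 \<phi>2 y \<longlonglongrightarrow> \<Psi> y" if "y \<in> ball x r" for y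
      unfolding iter using that by (rule conv)
    show "\<Psi> y \<in> ?M" if "y \<in> ball x r" for y using that by (rule lim_in)
    show "\<Psi> x = x" using xM x_in by (rule fixed)
    show "frechet_derivative \<Psi> (at x) \<eta> = \<eta>" if "\<eta> \<in> tangent_space ?M x" for \<eta>
      using tangent[OF xM x_in that] frechet_derivative_at[OF G(1)[OF x_in]] by simp
  qed
qed

theorem theorem2:
  fixes M1 M2 U\<^sub>M U \<Omega> K :: "'a::euclidean_space set"
    and \<phi>1 \<phi>2 :: "'a \<Rightarrow> 'a"
    and xbar :: 'a and p :: nat and \<delta>\<^sub>K :: real
  assumes "p \<ge> 2"
    and "embedded_submanifold p M1" and "embedded_submanifold p M2"
    and "xbar \<in> M1 \<inter> M2"
    and "local_sets p M1 M2 \<phi>1 \<phi>2 xbar U\<^sub>M U \<Omega> K"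
    and "\<forall>x\<in>K. intersect_cleanly_at p M1 M2 x"
    and "\<forall>x\<in>K. alternating_framework_at p M1 M2 \<phi>1 \<phi>2 U x"
    and "admissible_radius M1 M2 \<phi>1 \<phi>2 U \<Omega> K \<delta>\<^sub>K"
    and "decomposition_property p M1 M2 \<phi>1 \<phi>2 U K \<delta>\<^sub>K"
  shows "\<exists>\<rho>\<^sub>K>0.
    let M = M1 \<inter> M2;
        D\<^sub>K = {(x, \<eta>) \<in> tangent_bundle M. x \<in> \<Omega> \<and> norm \<eta> < \<rho>\<^sub>K};
        \<psi> = alt_limit \<phi>1 \<phi>2
    in (\<forall>(x, \<eta>) \<in> D\<^sub>K.
          iterates_well_defined \<phi>1 \<phi>2 U (x + \<eta>) \<and>
          alt_iterate \<phi>1 \<phi>2 (x + \<eta>) \<longlonglongrightarrow> \<psi> (x, \<eta>)) \<and>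
       \<psi> ` D\<^sub>K \<subseteq> M \<and> Ck_on_subset 1 D\<^sub>K \<psi> \<and>
       (\<forall>x\<in>K.
          (\<forall>\<eta> \<in> tangent_space M x. norm \<eta> < \<rho>\<^sub>K \<longrightarrow>
             iterates_well_defined \<phi>1 \<phi>2 U (x + \<eta>) \<and>
             alt_iterate \<phi>1 \<phi>2 (x + \<eta>) \<longlonglongrightarrow> \<psi> (x, \<eta>)) \<and>
          \<psi> (x, 0) = x \<and>
          ((\<lambda>\<eta>. \<psi> (x, \<eta>)) has_derivative (\<lambda>\<eta>. \<eta>)) (at 0 within tangent_space M x)) \<and>
       first_order_retraction M D\<^sub>K \<psi>"
proof -
  let ?M = "M1 \<inter> M2"
  let ?\<psi> = "alt_limit \<phi>1 \<phi>2"
  define \<Psi> where "\<Psi> y = lim (alt_iterate \<phi>1 \<phi>2 y)" for y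
  have \<psi>: "?\<psi> = (\<lambda>s. \<Psi> (fst s + snd s))"
    by (auto simp: alt_limit_def \<Psi>_def)
  have near: "\<exists>r>0. Ck_on 1 (ball x r) \<Psi> \<and>
      (\<forall>y\<in>ball x r. iterates_well_defined \<phi>1 \<phi>2 U y \<and> alt_iterate \<phi>1 \<phi>2 y \<longlonglongrightarrow> \<Psi> y \<and> \<Psi> y \<in> ?M) \<and>
      \<Psi> x = x \<and> (\<forall>\<eta>\<in>tangent_space ?M x. frechet_derivative \<Psi> (at x) \<eta> = \<eta>)"
    if x: "x \<in> K" for x
    by (rule alternating_limit_near_base_point[OF assms(1,5) bspec[OF assms(7) x] assms(8,9) x])
      (auto simp: \<Psi>_def[abs_def])
  \<comment> \<open>The Lebesgue number of the cover of \<open>K\<close> by these sets is the uniform radius; the tangent vectors at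
    the boundary points of \<open>\<Omega>\<close> are covered as well.\<close>
  define good where "good B \<longleftrightarrow> open B \<and> Ck_on 1 B \<Psi> \<and>
    (\<forall>y\<in>B. iterates_well_defined \<phi>1 \<phi>2 U y \<and> alt_iterate \<phi>1 \<phi>2 y \<longlonglongrightarrow> \<Psi> y \<and> \<Psi> y \<in> ?M)" for B
  have "compact K" using assms(5) unfolding local_sets_def Let_def by blast
  moreover have "K \<subseteq> \<Union> {B. good B}"
  proof
    fix x assume "x \<in> K"
    from near[OF this] obtain r where "r > 0" "good (ball x r)" unfolding good_def by auto
    then show "x \<in> \<Union> {B. good B}" by (intro UnionI[of "ball x r"]) auto
  qed
  ultimately obtain \<rho> where \<rho>: "\<rho> > 0" "\<And>x. x \<in> K \<Longrightarrow> \<exists>B\<in>{B. good B}. ball x \<rho> \<subseteq> B"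
    by (rule Heine_Borel_lemma) (auto simp: good_def)
  have good: "\<exists>B. good B \<and> x + \<eta> \<in> B" if x: "x \<in> K" and \<eta>: "norm \<eta> < \<rho>" for x \<eta>
  proof -
    obtain B where "good B" "ball x \<rho> \<subseteq> B" using \<rho>(2)[OF x] by blast
    moreover have "x + \<eta> \<in> ball x \<rho>" using \<eta> by (simp add: dist_norm)
    ultimately show ?thesis by blast
  qed
  then have orbit: "iterates_well_defined \<phi>1 \<phi>2 U (x + \<eta>) \<and>
      alt_iterate \<phi>1 \<phi>2 (x + \<eta>) \<longlonglongrightarrow> ?\<psi> (x, \<eta>) \<and> ?\<psi> (x, \<eta>) \<in> ?M"
    if "x \<in> K" "norm \<eta> < \<rho>" for x \<eta>
    using that unfolding \<psi> good_def by fastforce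
  have fixed: "?\<psi> (x, 0) = x" if "x \<in> K" for x
    using near[OF that] by (auto simp: \<psi>)
  define D where "D = {(x, \<eta>) \<in> tangent_bundle ?M. x \<in> \<Omega> \<and> norm \<eta> < \<rho>}"
  have \<Omega>K: "\<Omega> \<subseteq> K"
  proof -
    have "K = top_of_set ?M closure_of \<Omega>" "openin (top_of_set ?M) \<Omega>"
      using assms(5) unfolding local_sets_def Let_def by blast+
    then show ?thesis by (metis closure_of_subset openin_subset)
  qed
  have D: "x \<in> K" "\<eta> \<in> tangent_space ?M x" "norm \<eta> < \<rho>" if "(x, \<eta>) \<in> D" for x \<eta>
    using that \<Omega>K by (auto simp: D_def tangent_bundle_def)
  have C1: "Ck_on_subset 1 D ?\<psi>"
    unfolding Ck_on_subset_def
  proof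
    fix s assume "s \<in> D"
    then have "fst s \<in> K" "norm (snd s) < \<rho>" using D[of "fst s" "snd s"] by auto
    then obtain B where B: "good B" "fst s + snd s \<in> B" using good by blast
    let ?W = "{s. fst s + snd s \<in> B}"
    have "open ((\<lambda>s. fst s + snd s) -` B)"
      using B(1) unfolding good_def by (intro open_vimage continuous_intros) auto
    then have "open ?W" by (simp add: vimage_def)
    \<comment> \<open>The formula for \<open>\<psi>\<close> makes sense off the tangent bundle, so \<open>\<psi>\<close> is its own \<open>C\<^sup>1\<close> extension.\<close>
    moreover have "Ck_on 1 ?W ?\<psi>"
      using B(1) Ck_on_1_compose_add unfolding good_def \<psi> by blast
    ultimately show "\<exists>W g. open W \<and> s \<in> W \<and> Ck_on 1 W g \<and> (\<forall>y\<in>D \<inter> W. g y = ?\<psi> y)"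
      using B(2) by (intro exI[of _ ?W] exI[of _ ?\<psi>]) auto
  qed
  have deriv: "((\<lambda>\<eta>. ?\<psi> (x, \<eta>)) has_derivative frechet_derivative \<Psi> (at x)) (at 0)"
    and tangent: "\<And>\<eta>. \<eta> \<in> tangent_space ?M x \<Longrightarrow> frechet_derivative \<Psi> (at x) \<eta> = \<eta>"
    if x: "x \<in> K" for x
  proof -
    from near[OF x] obtain r where r: "r > 0" "Ck_on 1 (ball x r) \<Psi>"
      and tan: "\<And>\<eta>. \<eta> \<in> tangent_space ?M x \<Longrightarrow> frechet_derivative \<Psi> (at x) \<eta> = \<eta>" by blast
    have "(\<Psi> has_derivative frechet_derivative \<Psi> (at x)) (at (x + 0))"
      using has_derivative_frechet_derivative[OF r(2), of x] r(1) by simp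
    moreover have "((\<lambda>\<eta>. x + \<eta>) has_derivative (\<lambda>\<eta>. \<eta>)) (at 0)"
      by (auto intro!: derivative_eq_intros)
    ultimately show "((\<lambda>\<eta>. ?\<psi> (x, \<eta>)) has_derivative frechet_derivative \<Psi> (at x)) (at 0)"
      unfolding \<psi> using has_derivative_compose by fastforce
    show "frechet_derivative \<Psi> (at x) \<eta> = \<eta>" if "\<eta> \<in> tangent_space ?M x" for \<eta> using tan that .
  qed
  have at_zero: "((\<lambda>\<eta>. ?\<psi> (x, \<eta>)) has_derivative (\<lambda>\<eta>. \<eta>)) (at 0 within tangent_space ?M x)"
    if x: "x \<in> K" for x
    by (rule has_derivative_within_eq_on[OF has_derivative_at_withinI[OF deriv[OF x]]])
      (use tangent[OF x] in auto)
  have curve: "((\<lambda>t. ?\<psi> (x, t *\<^sub>R \<eta>)) has_vector_derivative \<eta>) (at 0)"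
    if x: "x \<in> K" and \<eta>: "\<eta> \<in> tangent_space ?M x" for x \<eta>
  proof -
    have "((\<lambda>t::real. t *\<^sub>R \<eta>) has_derivative (\<lambda>t. t *\<^sub>R \<eta>)) (at 0)"
      by (auto intro!: derivative_eq_intros)
    from has_derivative_compose[OF this, of "\<lambda>\<eta>. ?\<psi> (x, \<eta>)"] deriv[OF x]
    have "((\<lambda>t. ?\<psi> (x, t *\<^sub>R \<eta>)) has_derivative (\<lambda>t. frechet_derivative \<Psi> (at x) (t *\<^sub>R \<eta>))) (at 0)"
      by simp
    moreover have "frechet_derivative \<Psi> (at x) (t *\<^sub>R \<eta>) = t *\<^sub>R \<eta>" for t
      using linear_scale[OF has_derivative_linear[OF deriv[OF x]]] tangent[OF x \<eta>] by simp
    ultimately show ?thesis by (simp add: has_vector_derivative_def)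
  qed
  have "first_order_retraction ?M D ?\<psi>"
    unfolding first_order_retraction_def
    using C1 orbit fixed curve D by fastforce
  moreover have "\<forall>(x, \<eta>) \<in> D. iterates_well_defined \<phi>1 \<phi>2 U (x + \<eta>) \<and>
          alt_iterate \<phi>1 \<phi>2 (x + \<eta>) \<longlonglongrightarrow> ?\<psi> (x, \<eta>)"
    using orbit D by blast
  moreover have "?\<psi> ` D \<subseteq> ?M" using orbit D by force
  ultimately show ?thesis
    using \<rho>(1) C1 orbit fixed at_zero unfolding Let_def D_def by (intro exI[of _ \<rho>]) blast
qed

end
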